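(* Let $X$ be a normal Hausdorff space and let $d$ be a metric on $X$ (not necessarily compatible with the topology of $X$) with the property that the set $\{x\in X: d(x,A)\leq r\}$ is closed for every closed $A\subset X$ and every $r>0$. Let $\mu,\nu$ be Radon probability measures on $X$ with finite first $d$-moment. Then $$\inf_{\pi\in\Pi(\mu,\nu)}\int_{X\times X} d\,d\pi=\sup\left\{\int_X f\,d(\mu-\nu): f\in C(X),\ f \text{ is } 1\text{-Lipschitz with respect to } d\right\}$$ and the infimum is attained. Moreover, given $\pi\in\Pi(\mu,\nu)$, the infimum is attained at $\pi$ if and only if $\pi$ is concentrated on a $d$-cyclically monotonic subset of $X\times X$.
   Context: All topological notions (closed, continuous, Borel, Radon) refer to the topology of $X$ and the product topology of $X\times X$, not to the metric $d$. A Radon measure is a finite, Borel, countably additive measure which is regular and tight. A measure is "concentrated on $C$" if $C$ is measurable for it and the complement of $C$ is null. $C(X)$ denotes the continuous functions $X\to\mathbb{R}$ (not assumed bounded). $d(x,A)=\inf_{a\in A}d(x,a)$. $\mu$ has finite first $d$-moment if $\int_X d(x,x_0)\,d\mu(x)<\infty$ for some (hence all) $x_0\in X$. $\Pi(\mu,\nu)$ is the set of Radon probability measures $\pi$ on $X\times X$ whose marginals (pushforwards under the first and second coordinate projections) are $\mu$ and $\nu$, respectively. A set $C\subset X\times X$ is $d$-cyclically monotonic if for all $(x_1,y_1),\dots,(x_n,y_n)\in C$ and every permutation $\sigma$ of $\{1,\dots,n\}$, $\sum_{k=1}^n d(x_k,y_k)\leq\sum_{k=1}^n d(x_k,y_{\sigma(k)})$.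 *)

theory Defs
  imports "HOL-Probability.Probability"
begin

text \<open>
  Regularity is inner approximation of Borel sets by closed sets; for finite measures this is
  equivalent to outer approximation by open sets. Tightness is stated separately.
\<close>
definition radon_measure :: "'a::topological_space measure \<Rightarrow> bool" where
  "radon_measure M \<longleftrightarrow>
     sets M = sets borel \<and> finite_measure M \<and>
     (\<forall>B\<in>sets borel. \<forall>e>0. \<exists>F. closed F \<and> F \<subseteq> B \<and> measure M (B - F) < e) \<and>
     (\<forall>e>0. \<exists>K. compact K \<and> K \<in> sets M \<and> measure M (UNIV - K) < e)"

text \<open>Measurability of \<open>C\<close> is with respect to the measure, i.e. to its completion.\<close>
definition concentrated_on :: "'a measure \<Rightarrow> 'a set \<Rightarrow> bool" where
  "concentrated_on M C \<longleftrightarrow>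
     C \<in> sets (completion M) \<and> emeasure (completion M) (space M - C) = 0"

text \<open>Extended-real valued, so that the distance to the empty set is \<open>\<infinity>\<close>.\<close>
definition set_distance :: "('a \<Rightarrow> 'a \<Rightarrow> real) \<Rightarrow> 'a \<Rightarrow> 'a set \<Rightarrow> ereal" where
  "set_distance d x A = (INF a\<in>A. ereal (d x a))"

definition finite_first_moment :: "('a \<Rightarrow> 'a \<Rightarrow> real) \<Rightarrow> 'a measure \<Rightarrow> bool" where
  "finite_first_moment d M \<longleftrightarrow> (\<exists>x0. (\<integral>\<^sup>+ x. ennreal (d x x0) \<partial>M) < \<infinity>)"

text \<open>
  The Borel sigma-algebra on the product type is that of the product topology, which in general
  is larger than the product of the Borel sigma-algebras.
\<close>
definition couplings ::
    "'a::topological_space measure \<Rightarrow> 'a measure \<Rightarrow> ('a \<times> 'a) measure set" where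
  "couplings \<mu> \<nu> =
     {\<pi>. radon_measure \<pi> \<and> prob_space \<pi> \<and> distr \<pi> borel fst = \<mu> \<and> distr \<pi> borel snd = \<nu>}"

definition transport_cost :: "('a \<Rightarrow> 'a \<Rightarrow> real) \<Rightarrow> ('a \<times> 'a) measure \<Rightarrow> ennreal" where
  "transport_cost d \<pi> = (\<integral>\<^sup>+ p. ennreal (d (fst p) (snd p)) \<partial>\<pi>)"

definition continuous_lipschitz1 ::
    "('a::topological_space \<Rightarrow> 'a \<Rightarrow> real) \<Rightarrow> ('a \<Rightarrow> real) set" where
  "continuous_lipschitz1 d =
     {f. continuous_on UNIV f \<and> (\<forall>x y. \<bar>f x - f y\<bar> \<le> d x y)}"

definition cyclically_monotonic :: "('a \<Rightarrow> 'a \<Rightarrow> real) \<Rightarrow> ('a \<times> 'a) set \<Rightarrow> bool" where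
  "cyclically_monotonic d C \<longleftrightarrow>
     (\<forall>(n::nat) (x::nat \<Rightarrow> 'a) (y::nat \<Rightarrow> 'a) \<sigma>.
        (\<forall>k\<in>{1..n}. (x k, y k) \<in> C) \<and> \<sigma> permutes {1..n} \<longrightarrow>
        (\<Sum>k=1..n. d (x k) (y k)) \<le> (\<Sum>k=1..n. d (x k) (y (\<sigma> k))))"

end

theory Submission
  imports Defs
begin

text \<open>
  The assumption on \<open>d\<close> makes \<open>d\<close> lower semicontinuous on \<open>X \<times> X\<close> and gives, by a Urysohn
  construction over rational levels, continuous functions of Lipschitz constant arbitrarily close
  to 1 between finitely many prescribed lower and upper bounds on closed sets. By inner regularity
  it follows that \<open>\<integral>\<phi> d\<mu> + \<integral>\<psi> d\<nu>\<close> is at most the dual supremum \<open>S\<close> for all bounded Borel \<open>\<phi>\<close>, \<open>\<psi>\<close>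
  with \<open>\<phi>(x) + \<psi>(y) \<le> d(x, y)\<close>. Hahn-Banach then yields a finitely additive plan on all subsets of
  \<open>X \<times> X\<close> with marginals \<open>\<mu>\<close>, \<open>\<nu>\<close> and cost at most \<open>S\<close>. Tight marginals allow it to be regularized
  to a Radon measure, and since this does not increase the measure of open sets and \<open>d\<close> is lower
  semicontinuous, the cost stays below \<open>S\<close>.

  If \<open>\<pi>\<close> is optimal, then for a maximizing sequence \<open>f\<^sub>n\<close> a subsequence of \<open>f\<^sub>n(x) - f\<^sub>n(y)\<close> converges to
  \<open>d(x, y)\<close> almost everywhere, and the set of convergence is cyclically monotonic. Conversely, a
  cyclically monotonic set of full measure contains compact sets of almost full measure on which \<open>d\<close>
  is continuous, and on these Rockafellar's potential is Borel and certifies optimality up to \<open>\<epsilon>\<close>.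
\<close>

subsection \<open>Continuous Lipschitz functions between semicontinuous bounds\<close>

text \<open>The topology need not be metrizable and \<open>d\<close> need not be continuous for it.
  The plan is therefore sought among set functions on all subsets, where Hahn-Banach meets no
  measurability condition; countable additivity is given up there and regained from compactness
  alone. Only one-sided inequalities survive this passage, so the marginals are read off from
  compact rectangles and the cost from the open superlevel sets of \<open>d\<close>. Two losses
  shape the rest. Distances to sets are infima that need not be attained, so every separation costs
  some slope: the functions constructed have Lipschitz constant \<open>1 / \<kappa>\<close>, and
  scaling by \<kappa> < 1 repairs this in the limit. Rockafellar's potential is an infimum over
  possibly uncountably many chains, so its measurability is not automatic; hence the restriction to
  compact sets and a potential that depends on \<epsilon>, in place of a maximizer of the dual
  problem.\<close>

locale closed_nbd_metric = Metric_space UNIV d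
  for d :: "'a::t4_space \<Rightarrow> 'a \<Rightarrow> real" +
  assumes closed_nbd': "closed A \<Longrightarrow> r > 0 \<Longrightarrow> closed {x. set_distance d x A \<le> ereal r}"
begin

definition nbd :: "'a set \<Rightarrow> real \<Rightarrow> 'a set" where
  "nbd A r = {x. set_distance d x A \<le> ereal r}"

lemma closed_nbd: "closed A \<Longrightarrow> r > 0 \<Longrightarrow> closed (nbd A r)"
  unfolding nbd_def by (rule closed_nbd')

lemma nbdI: "y \<in> A \<Longrightarrow> d x y \<le> r \<Longrightarrow> x \<in> nbd A r"
  unfolding nbd_def set_distance_def by (auto intro: INF_lower2)

text \<open>The infimum need not be attained, so a point of \<open>A\<close> is available only at a
  radius \<open>r' > r\<close>. This is the source of all the strict gaps between radii and slopes
  below.\<close>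

lemma nbdE:
  assumes "x \<in> nbd A r" "r < r'"
  obtains y where "y \<in> A" "d x y < r'"
proof -
  have "(INF a\<in>A. ereal (d x a)) < ereal r'"
    using assms by (auto simp: nbd_def set_distance_def intro: le_less_trans)
  then show ?thesis using that by (auto simp: INF_less_iff)
qed

lemma nbd_mono: "r \<le> r' \<Longrightarrow> nbd A r \<subseteq> nbd A r'"
  unfolding nbd_def by (auto intro: order_trans)

lemma subset_nbd: "0 \<le> r \<Longrightarrow> A \<subseteq> nbd A r"
  by (auto intro!: nbdI simp: mdist_zero)

text \<open>Lower semicontinuity of \<open>d\<close> in both variables jointly. The hypothesis is
  used twice: for the ball around \<open>y0\<close>, which regularity separates from
  \<open>x0\<close>, and for the complement of the open set \<open>V\<close> around that ball, which
  stays away from \<open>y0\<close>.\<close>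

lemma open_dist_greater: "open {p. r < d (fst p) (snd p)}"
proof (cases "r < 0")
  case True
  then have "{p. r < d (fst p) (snd p)} = UNIV"
    using nonneg by (auto intro: less_le_trans)
  then show ?thesis by simp
next
  case False
  show ?thesis
    unfolding open_prod_def
  proof safe
    fix x0 y0 assume "r < d (fst (x0, y0)) (snd (x0, y0))"
    then have gt: "r < d x0 y0" by simp
    \<comment> \<open>\<open>s > r\<close> makes the radius positive even for \<open>r = 0\<close>;
      the gaps from \<open>s\<close> to \<open>s'\<close> and from \<open>s'\<close> to
      \<open>d x0 y0\<close> pay for infima that are not attained.\<close>
    define s where "s = (2 * r + d x0 y0) / 3"
    define s' where "s' = (r + 2 * d x0 y0) / 3"
    have s: "r < s" "s < s'" "s' < d x0 y0" using gt by (auto simp: s_def s'_def)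
    have x0: "x0 \<notin> nbd {y0} s'" using s by (auto elim: nbdE)
    have "closed (nbd {y0} s')" using s False by (intro closed_nbd) auto
    from t3_space[OF this x0] obtain U V where UV: "open U" "open V" "x0 \<in> U" "nbd {y0} s' \<subseteq> V" "U \<inter> V = {}"
      by blast
    have cl: "closed (- V)" using UV by auto
    have "y0 \<notin> nbd (- V) s"
    proof
      assume "y0 \<in> nbd (- V) s"
      then obtain z where z: "z \<in> - V" "d y0 z < s'" using s by (auto elim: nbdE)
      then have "z \<in> nbd {y0} s'" using commute by (intro nbdI) auto
      with z UV show False by auto
    qed
    moreover have "closed (nbd (- V) s)" using s False cl by (intro closed_nbd) auto
    moreover have "r < d x y" if "x \<in> U" "y \<notin> nbd (- V) s" for x y
    proof (rule ccontr)
      assume "\<not> r < d x y"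
      then have "y \<in> nbd (- V) s"
        using s that UV commute[of x y] by (intro nbdI[of x]) auto
      with that show False by simp
    qed
    ultimately show "\<exists>A B. open A \<and> open B \<and> (x0, y0) \<in> A \<times> B \<and>
        A \<times> B \<subseteq> {p. r < d (fst p) (snd p)}"
      using UV by (intro exI[of _ U] exI[of _ "- nbd (- V) s"]) auto
  qed
qed

text \<open>A pair \<open>(t, A)\<close> in \<open>\<L>\<close> stands for the demand
  \<open>f \<ge> t\<close> on \<open>A\<close>, a pair \<open>(s, B)\<close> in \<open>\<U>\<close>
  for \<open>f \<le> s\<close> on \<open>B\<close>. A function with
  \<open>L * \<bar>f x - f y\<bar> \<le> d x y\<close> can meet both only if \<open>A\<close> and
  \<open>B\<close> are at distance at least \<open>L * (t - s)\<close>. A larger \<open>L\<close> is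
  the stronger condition.\<close>

definition compatible :: "real \<Rightarrow> (real \<times> 'a set) set \<Rightarrow> (real \<times> 'a set) set \<Rightarrow> bool" where
  "compatible L \<L> \<U> \<longleftrightarrow>
     (\<forall>(t, A)\<in>\<L>. \<forall>(s, B)\<in>\<U>. s < t \<longrightarrow> nbd A (L * (t - s)) \<inter> B = {})"

lemma compatibleD:
  "compatible L \<L> \<U> \<Longrightarrow> (t, A) \<in> \<L> \<Longrightarrow> (s, B) \<in> \<U> \<Longrightarrow> s < t \<Longrightarrow> nbd A (L * (t - s)) \<inter> B = {}"
  unfolding compatible_def by blast

lemma compatible_mono:
  assumes "compatible L \<L> \<U>" "L' \<le> L"
  shows "compatible L' \<L> \<U>"
  unfolding compatible_def
proof safe
  fix t A s B x
  assume *: "(t, A) \<in> \<L>" "(s, B) \<in> \<U>" "s < t" "x \<in> nbd A (L' * (t - s))" "x \<in> B"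
  have "nbd A (L' * (t - s)) \<subseteq> nbd A (L * (t - s))"
    using * assms by (intro nbd_mono mult_right_mono) auto
  then show "x \<in> {}" using compatibleD[OF assms(1) *(1,2,3)] * by auto
qed

text \<open>
  The loss of slope from \<open>L\<close> to \<open>L'\<close> leaves room between the closed sets that a new level has to
  separate, so that normality applies.
\<close>

lemma compatible_insert_level:
  assumes fin: "finite \<L>" "finite \<U>"
    and cl: "\<And>t A. (t, A) \<in> \<L> \<Longrightarrow> closed A" "\<And>t A. (t, A) \<in> \<U> \<Longrightarrow> closed A"
    and comp: "compatible L \<L> \<U>" and L': "0 < L'" "L' < L"
  obtains F W where "closed F" "open W" "W \<subseteq> F"
    "compatible L' (insert (m, F) \<L>) (insert (m, - W) \<U>)"
proof -
  define M where "M = (L' + L) / 2"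
  have M: "L' < M" "M < L" using L' by (auto simp: M_def)
  \<comment> \<open>The new level set has to contain \<open>P\<close> and avoid \<open>Q\<close>.
    The radius in \<open>Q\<close> uses \<open>M > L'\<close> because \<open>- V\<close> is only
    known to miss \<open>Q\<close>, and a point near \<open>- V\<close> gives a point of
    \<open>- V\<close> only at a larger radius; \<open>P \<subseteq> W\<close> is used directly.
    Both slopes lie below \<open>L\<close>, which makes \<open>P\<close> and \<open>Q\<close>
    disjoint.\<close>
  define P where "P = (\<Union>(t, A)\<in>{z\<in>\<L>. m < fst z}. nbd A (L' * (t - m)))"
  define Q where "Q = (\<Union>(s, B)\<in>{z\<in>\<U>. fst z < m}. nbd B (M * (m - s)))"
  have P: "closed P" unfolding P_def using fin cl L' by (auto intro!: closed_UN closed_nbd)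
  have Q: "closed Q" unfolding Q_def using fin cl L' M by (auto intro!: closed_UN closed_nbd)
  have PQ: "P \<inter> Q = {}"
  proof (rule ccontr)
    assume "P \<inter> Q \<noteq> {}"
    then obtain x t A s B where x: "(t, A) \<in> \<L>" "m < t" "x \<in> nbd A (L' * (t - m))"
      "(s, B) \<in> \<U>" "s < m" "x \<in> nbd B (M * (m - s))"
      unfolding P_def Q_def by fastforce
    from x have "L' * (t - m) < L * (t - m)" "M * (m - s) < L * (m - s)"
      using L' M by (auto intro!: mult_strict_right_mono)
    then obtain y z where yz: "y \<in> A" "d x y < L * (t - m)" "z \<in> B" "d x z < L * (m - s)"
      using x by (meson nbdE)
    have "d z y \<le> d x z + d x y" using triangle[of z x y] commute[of x z] by simp
    also have "\<dots> \<le> L * (t - s)" using yz by (simp add: algebra_simps)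
    finally have "z \<in> nbd A (L * (t - s))" using yz by (intro nbdI)
    moreover have "s < t" using x by simp
    ultimately show False using compatibleD[OF comp x(1,4)] yz by auto
  qed
  obtain W V where W: "open W" "open V" "P \<subseteq> W" "Q \<subseteq> V" "W \<inter> V = {}"
    using t4_space[OF P Q PQ] by blast
  have "compatible L' (insert (m, - V) \<L>) (insert (m, - W) \<U>)"
    unfolding compatible_def
  proof safe
    fix s B x assume *: "(s, B) \<in> \<U>" "s < m" "x \<in> nbd (- V) (L' * (m - s))" "x \<in> B"
    have "L' * (m - s) < M * (m - s)" using * M by (auto intro!: mult_strict_right_mono)
    then obtain y where y: "y \<in> - V" "d x y < M * (m - s)" using * by (meson nbdE)
    then have "y \<in> nbd B (M * (m - s))" using * commute[of x y] by (intro nbdI[of x]) auto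
    then have "y \<in> Q" using * unfolding Q_def by auto
    then show "x \<in> {}" using y W by auto
  next
    fix t A x assume *: "(t, A) \<in> \<L>" "m < t" "x \<in> nbd A (L' * (t - m))" "x \<notin> W"
    then have "x \<in> P" unfolding P_def by auto
    then show "x \<in> {}" using * W by auto
  next
    fix t A s B x
    assume *: "(t, A) \<in> \<L>" "(s, B) \<in> \<U>" "s < t" "x \<in> nbd A (L' * (t - s))" "x \<in> B"
    then show "x \<in> {}" using compatibleD[OF compatible_mono[OF comp less_imp_le[OF L'(2)]] *(1,2,3)] by auto
  qed
  moreover have "closed (- V)" "W \<subseteq> - V" using W by auto
  ultimately show ?thesis using that W by blast
qed

text \<open>Each rational level is inserted at some finite stage at the price of some slope, and the
  budget between 1 and \<kappa> is spread over the infinitely many stages. The two demands on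
  \<open>UNIV\<close> bound \<open>f\<close> from both sides, so that the supremum defining it
  exists.\<close>

theorem insertion_continuous_lipschitz:
  fixes \<L> \<U> :: "(real \<times> 'a set) set"
  assumes fin: "finite \<L>" "finite \<U>"
    and cl: "\<And>t A. (t, A) \<in> \<L> \<Longrightarrow> closed A" "\<And>t A. (t, A) \<in> \<U> \<Longrightarrow> closed A"
    and bd: "(a, UNIV) \<in> \<L>" "(b, UNIV) \<in> \<U>"
    and dist: "\<And>t A s B x y. (t, A) \<in> \<L> \<Longrightarrow> (s, B) \<in> \<U> \<Longrightarrow> x \<in> A \<Longrightarrow> y \<in> B \<Longrightarrow> t - s \<le> d x y"
    and \<kappa>: "0 < \<kappa>" "\<kappa> < 1"
  obtains f where "continuous_on UNIV f" "\<And>x y. \<kappa> * \<bar>f x - f y\<bar> \<le> d x y"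
    "\<And>t A x. (t, A) \<in> \<L> \<Longrightarrow> x \<in> A \<Longrightarrow> t \<le> f x"
    "\<And>s B x. (s, B) \<in> \<U> \<Longrightarrow> x \<in> B \<Longrightarrow> f x \<le> s"
proof -
  define q :: "nat \<Rightarrow> real" where "q = from_nat_into \<rat>"
  have q: "range q = \<rat>"
    unfolding q_def using Rats_0 by (intro range_from_nat_into countable_rat) auto
  have q_dense: "\<exists>i. x < q i \<and> q i < y" if xy: "x < y" for x y
  proof -
    obtain r where "r \<in> \<rat>" "x < r" "r < y" using Rats_dense_in_real[OF xy] by blast
    then show ?thesis using q by (metis rangeE)
  qed
  \<comment> \<open>The start lies strictly below 1 because \<open>dist\<close> allows equality
    whereas \<open>compatible\<close> is strict; every value stays above \<kappa>, so all stages are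
    compatible at the common slope \<kappa>.\<close>
  define L where "L = (\<lambda>n::nat. \<kappa> + (1 - \<kappa>) / (real n + 2))"
  have L: "\<kappa> < L n" "L (Suc n) < L n" "L n < 1" for n
  proof -
    show "\<kappa> < L n" using \<kappa> by (simp add: L_def)
    show "L (Suc n) < L n" using \<kappa> by (auto simp: L_def intro!: divide_strict_left_mono)
    have "(1 - \<kappa>) / (real n + 2) \<le> (1 - \<kappa>) / 2" using \<kappa> by (intro divide_left_mono) auto
    also have "\<dots> < 1 - \<kappa>" using \<kappa> by simp
    finally show "L n < 1" by (simp add: L_def)
  qed
  define ok where "ok = (\<lambda>n (\<L>' :: (real \<times> 'a set) set, \<U>' :: (real \<times> 'a set) set).
     finite \<L>' \<and> finite \<U>' \<and> (\<forall>(t, A)\<in>\<L>'. closed A) \<and> (\<forall>(t, A)\<in>\<U>'. closed A) \<and>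
     compatible (L n) \<L>' \<U>' \<and> \<L> \<subseteq> \<L>' \<and> \<U> \<subseteq> \<U>')"
  define extend where "extend = (\<lambda>n z z' :: (real \<times> 'a set) set \<times> (real \<times> 'a set) set. \<exists>F W. closed F \<and> open W \<and> W \<subseteq> F \<and>
     z' = (insert (q n, F) (fst z), insert (q n, - W) (snd z)))"
  have "\<exists>z. \<forall>n. ok n (z n) \<and> extend n (z n) (z (Suc n))"
  proof (rule dependent_nat_choice)
    have "compatible (L 0) \<L> \<U>"
      unfolding compatible_def
    proof safe
      fix t A s B x
      assume *: "(t, A) \<in> \<L>" "(s, B) \<in> \<U>" "s < t" "x \<in> nbd A (L 0 * (t - s))" "x \<in> B"
      have "L 0 * (t - s) < 1 * (t - s)" using * L by (intro mult_strict_right_mono) auto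
      then obtain y where "y \<in> A" "d x y < t - s" using * by (metis mult_1 nbdE)
      then show "x \<in> {}" using dist[OF *(1,2), of y x] * commute[of x y] by auto
    qed
    then show "\<exists>z. ok 0 z" using fin cl by (intro exI[of _ "(\<L>, \<U>)"]) (auto simp: ok_def)
  next
    fix z n assume "ok n z"
    obtain \<L>' \<U>' where z: "z = (\<L>', \<U>')" by (cases z)
    have ok: "finite \<L>'" "finite \<U>'" "\<forall>(t, A)\<in>\<L>'. closed A" "\<forall>(t, A)\<in>\<U>'. closed A"
      "compatible (L n) \<L>' \<U>'" "\<L> \<subseteq> \<L>'" "\<U> \<subseteq> \<U>'"
      using \<open>ok n z\<close> by (simp_all add: ok_def z)
    have cl': "closed A" if "(t, A) \<in> \<L>' \<or> (t, A) \<in> \<U>'" for t A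
      using ok(3,4) that by auto
    obtain F W where FW: "closed F" "open W" "W \<subseteq> F"
      "compatible (L (Suc n)) (insert (q n, F) \<L>') (insert (q n, - W) \<U>')"
      by (rule compatible_insert_level[OF ok(1,2) _ _ ok(5) order_less_trans[OF \<kappa>(1) L(1)] L(2)])
        (use cl' in blast)+
    have "ok (Suc n) (insert (q n, F) \<L>', insert (q n, - W) \<U>')"
      using ok FW by (simp add: ok_def) blast
    moreover have "extend n z (insert (q n, F) \<L>', insert (q n, - W) \<U>')"
      using FW by (auto simp: extend_def z)
    ultimately show "\<exists>z'. ok (Suc n) z' \<and> extend n z z'" by blast
  qed
  then obtain z where ok: "\<And>n. ok n (z n)" and nxt: "\<And>n. extend n (z n) (z (Suc n))" by blast
  have "\<forall>n. \<exists>F W. closed F \<and> open W \<and> W \<subseteq> F \<and>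
     z (Suc n) = (insert (q n, F) (fst (z n)), insert (q n, - W) (snd (z n)))"
    using nxt unfolding extend_def by blast
  then obtain F W where FW: "\<And>n. closed (F n)" "\<And>n. open (W n)" "\<And>n. W n \<subseteq> F n"
    and zS: "\<And>n. z (Suc n) = (insert (q n, F n) (fst (z n)), insert (q n, - W n) (snd (z n)))"
    by metis
  have mono: "fst (z i) \<subseteq> fst (z j)" "snd (z i) \<subseteq> snd (z j)" if "i \<le> j" for i j
    using that by (induction j rule: dec_induct) (auto simp: zS)
  have comp: "compatible \<kappa> (fst (z n)) (snd (z n))" for n
    using ok[of n] L(1)[of n] by (auto simp: ok_def split: prod.splits intro: compatible_mono less_imp_le)
  have sub: "\<L> \<subseteq> fst (z n)" "\<U> \<subseteq> snd (z n)" for n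
    using ok[of n] by (auto simp: ok_def split: prod.splits)
  have inF: "(q n, F n) \<in> fst (z (Suc n))" and inW: "(q n, - W n) \<in> snd (z (Suc n))" for n
    by (auto simp: zS)
  \<comment> \<open>Both levels are present from a common finite stage on, whatever the order of
    their insertion, so compatibility there relates any two of them.\<close>
  have FW_nbd: "nbd (F i) (\<kappa> * (q i - q j)) \<subseteq> W j" if "q j < q i" for i j
  proof -
    define N where "N = max (Suc i) (Suc j)"
    have "(q i, F i) \<in> fst (z N)" "(q j, - W j) \<in> snd (z N)"
      using inF[of i] inW[of j] mono(1)[of "Suc i" N] mono(2)[of "Suc j" N] by (auto simp: N_def)
    from compatibleD[OF comp this that] show ?thesis by auto
  qed
  have FW_sub: "F i \<subseteq> W j" if "q j < q i" for i j
  proof -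
    have "0 \<le> \<kappa> * (q i - q j)" using that \<kappa> by simp
    from subset_nbd[OF this, of "F i"] FW_nbd[OF that] show ?thesis by (rule order_trans)
  qed
  have AW: "A \<subseteq> W j" if "(t, A) \<in> \<L>" "q j < t" for t A j
  proof -
    have "(t, A) \<in> fst (z (Suc j))" using sub(1)[of "Suc j"] that by blast
    from compatibleD[OF comp this inW that(2)] have "nbd A (\<kappa> * (t - q j)) \<subseteq> W j" by auto
    moreover have "0 \<le> \<kappa> * (t - q j)" using that \<kappa> by simp
    ultimately show ?thesis using subset_nbd by blast
  qed
  have FB: "F i \<inter> B = {}" if "(s, B) \<in> \<U>" "s < q i" for s B i
  proof -
    have "(s, B) \<in> snd (z (Suc i))" using sub(2)[of "Suc i"] that by blast
    from compatibleD[OF comp inF this that(2)] have "nbd (F i) (\<kappa> * (q i - s)) \<inter> B = {}" .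
    moreover have "0 \<le> \<kappa> * (q i - s)" using that \<kappa> by simp
    ultimately show ?thesis using subset_nbd by blast
  qed
  \<comment> \<open>Since \<open>W i \<subseteq> F i \<subseteq> W j\<close> for
    \<open>q j < q i\<close>, the open sets \<open>W j\<close> bound \<open>f\<close> from below by
    \<open>q j\<close> and the open sets \<open>- F i\<close> bound it from above by
    \<open>q i\<close>; this is the continuity.\<close>
  define f where "f = (\<lambda>x. Sup {q i | i. x \<in> F i})"
  have bdd: "bdd_above {q i | i. x \<in> F i}" for x
    using FB[OF bd(2)] by (intro bdd_aboveI[of _ b]) (auto simp: not_less[symmetric])
  have ne: "{q i | i. x \<in> F i} \<noteq> {}" for x
  proof -
    obtain i where "q i < a" using q_dense[of "a - 1" a] by auto
    then show ?thesis using AW[OF bd(1)] FW(3) by blast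
  qed
  have f_ge: "q i \<le> f x" if "x \<in> F i" for i x
    unfolding f_def using that by (intro cSup_upper[OF _ bdd]) auto
  have f_le: "f x \<le> c" if "\<And>i. x \<in> F i \<Longrightarrow> q i \<le> c" for x c
    unfolding f_def using that by (intro cSup_least[OF ne]) auto
  have f_gtE: "\<exists>i. x \<in> F i \<and> c < q i" if "c < f x" for x c
    using f_le[of x c] that by (meson not_less)
  show ?thesis
  proof
    show "continuous_on UNIV f"
      unfolding continuous_on_eq_continuous_at[OF open_UNIV] isCont_def
    proof (intro ballI order_tendstoI)
      fix x c assume "c < f x"
      then obtain i where i: "x \<in> F i" "c < q i" using f_gtE by blast
      obtain j where j: "c < q j" "q j < q i" using q_dense i by blast
      have "x \<in> W j" using FW_sub j i by blast
      moreover have "c < f y" if "y \<in> W j" for y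
        using f_ge[of y j] that FW(3)[of j] j by auto
      ultimately show "\<forall>\<^sub>F y in at x. c < f y"
        using FW(2)[of j] unfolding eventually_at_topological by blast
    next
      fix x c assume "f x < c"
      then obtain i where i: "f x < q i" "q i < c" using q_dense by blast
      have "x \<in> - F i" using f_ge[of x i] i by auto
      moreover have "f y < c" if y: "y \<in> - F i" for y
      proof -
        have "f y \<le> q i"
        proof (rule f_le, rule ccontr)
          fix k assume "y \<in> F k" "\<not> q k \<le> q i"
          then show False using FW_sub[of i k] FW(3)[of i] y by auto
        qed
        then show ?thesis using i by simp
      qed
      moreover have "open (- F i)" using FW by auto
      ultimately show "\<forall>\<^sub>F y in at x. f y < c"
        unfolding eventually_at_topological by blast
    qed
    have *: "\<kappa> * (f x - f y) \<le> d x y" for x y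
    proof (rule ccontr)
      assume "\<not> \<kappa> * (f x - f y) \<le> d x y"
      then have "f y + d x y / \<kappa> < f x" using \<kappa> by (simp add: field_simps)
      then obtain i where i: "x \<in> F i" "f y + d x y / \<kappa> < q i" using f_gtE by blast
      then have "f y < q i - d x y / \<kappa>" by simp
      then obtain j where j: "f y < q j" "q j < q i - d x y / \<kappa>" using q_dense by blast
      then have le: "d x y < \<kappa> * (q i - q j)" using \<kappa> by (simp add: field_simps)
      have "0 \<le> d x y / \<kappa>" using \<kappa> by simp
      then have "q j < q i" using j by simp
      moreover have "y \<in> nbd (F i) (\<kappa> * (q i - q j))" using le i commute[of x y] by (intro nbdI[of x]) auto
      ultimately have "y \<in> F j" using FW_nbd FW(3) by blast
      then show False using f_ge[of y j] j by simp
    qed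
    show "\<kappa> * \<bar>f x - f y\<bar> \<le> d x y" for x y
      using *[of x y] *[of y x] commute[of x y] by (auto simp: abs_if)
    show "t \<le> f x" if "(t, A) \<in> \<L>" "x \<in> A" for t A x
    proof (rule dense_le)
      fix c assume "c < t"
      then obtain j where "c < q j" "q j < t" using q_dense by blast
      then show "c \<le> f x" using AW[OF that(1)] that f_ge[of x j] FW(3)[of j] by force
    qed
    show "f x \<le> s" if "(s, B) \<in> \<U>" "x \<in> B" for s B x
      using FB[OF that(1)] that(2) by (intro f_le) (meson disjoint_iff not_less)
  qed
qed

end

subsection \<open>Sublinear functionals on function spaces\<close>

text \<open>Homogeneity is asked only as an inequality, which is easy to check for infima. Equality
  follows by applying it to \<open>1 / c\<close> as well.\<close>

definition sublinear_on :: "('b \<Rightarrow> real) set \<Rightarrow> (('b \<Rightarrow> real) \<Rightarrow> real) \<Rightarrow> bool" where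
  "sublinear_on V p \<longleftrightarrow>
     (\<forall>f\<in>V. \<forall>g\<in>V. p (\<lambda>x. f x + g x) \<le> p f + p g) \<and>
     (\<forall>f\<in>V. \<forall>c>0. p (\<lambda>x. c * f x) \<le> c * p f)"

lemma sublinear_on_add:
  "sublinear_on V p \<Longrightarrow> f \<in> V \<Longrightarrow> g \<in> V \<Longrightarrow> p (\<lambda>x. f x + g x) \<le> p f + p g"
  by (simp add: sublinear_on_def)

lemma sublinear_on_scale:
  "sublinear_on V p \<Longrightarrow> f \<in> V \<Longrightarrow> 0 < c \<Longrightarrow> p (\<lambda>x. c * f x) \<le> c * p f"
  by (simp add: sublinear_on_def)

lemma sublinear_on_zero:
  assumes "sublinear_on V p" "(\<lambda>x. 0) \<in> V"
  shows "p (\<lambda>x. 0) = 0"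
  using sublinear_on_scale[OF assms, of 2] sublinear_on_scale[OF assms, of "1/2"] by simp

lemma sublinear_on_scale_eq:
  assumes p: "sublinear_on V p" and V: "\<And>f c. f \<in> V \<Longrightarrow> (\<lambda>x. c * f x) \<in> V"
    and "f \<in> V" "0 < c"
  shows "p (\<lambda>x. c * f x) = c * p f"
proof -
  have "p f \<le> (1 / c) * p (\<lambda>x. c * f x)"
    using sublinear_on_scale[OF p V[OF \<open>f \<in> V\<close>, of c], of "1 / c"] \<open>0 < c\<close> by simp
  then have "c * p f \<le> p (\<lambda>x. c * f x)" using \<open>0 < c\<close> by (simp add: field_simps)
  with sublinear_on_scale[OF p] assms show ?thesis by (metis order_antisym)
qed

text \<open>A minimal sublinear functional below \<open>p\<close> is linear.\<close>

theorem Hahn_Banach_functions: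
  fixes p :: "('b \<Rightarrow> real) \<Rightarrow> real"
  assumes add: "\<And>f g. f \<in> V \<Longrightarrow> g \<in> V \<Longrightarrow> (\<lambda>x. f x + g x) \<in> V"
    and scale: "\<And>f c. f \<in> V \<Longrightarrow> (\<lambda>x. c * f x) \<in> V"
    and p: "sublinear_on V p"
  obtains \<Lambda> where "\<And>f. f \<in> V \<Longrightarrow> \<Lambda> f \<le> p f"
    "\<And>f g. f \<in> V \<Longrightarrow> g \<in> V \<Longrightarrow> \<Lambda> (\<lambda>x. f x + g x) = \<Lambda> f + \<Lambda> g"
    "\<And>f c. f \<in> V \<Longrightarrow> 0 < c \<Longrightarrow> \<Lambda> (\<lambda>x. c * f x) = c * \<Lambda> f"
proof -
  have neg: "(\<lambda>x. - f x) \<in> V" if "f \<in> V" for f using scale[OF that, of "-1"] by simp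
  have zero: "(\<lambda>x. 0) \<in> V" if "f \<in> V" for f using scale[OF that, of 0] by simp
  have lower: "- q (\<lambda>x. - f x) \<le> q f" if "sublinear_on V q" "f \<in> V" for q f
    using sublinear_on_add[OF that neg[OF that(2)]] sublinear_on_zero[OF that(1) zero[OF that(2)]] by simp
  \<comment> \<open>Values off \<open>V\<close> are pinned to 0, so that the order on all arguments
    is the order on \<open>V\<close>. The order \<open>P\<close> is reversed: the maximal element
    given by Zorn's lemma is a minimal functional.\<close>
  define S where "S = {q. sublinear_on V q \<and> (\<forall>f\<in>V. q f \<le> p f) \<and> (\<forall>f. f \<notin> V \<longrightarrow> q f = 0)}"
  define P where "P = (\<lambda>q q' :: ('b \<Rightarrow> real) \<Rightarrow> real. \<forall>f. q' f \<le> q f)"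
  \<comment> \<open>A lower bound that does not depend on \<open>q\<close>, so that infima over
    chains are finite.\<close>
  have S_ge: "- p (\<lambda>x. - f x) \<le> q f" if "q \<in> S" "f \<in> V" for q f
  proof -
    have "sublinear_on V q" "q (\<lambda>x. - f x) \<le> p (\<lambda>x. - f x)"
      using that neg[OF that(2)] by (auto simp: S_def)
    then show ?thesis using lower[of q f] that by simp
  qed
  have "\<exists>m\<in>S. \<forall>q\<in>S. P m q \<longrightarrow> q = m"
  proof (rule predicate_Zorn)
    show "partial_order_on S (relation_of P S)"
      by (rule partial_order_on_relation_ofI) (auto simp: P_def fun_eq_iff intro: order_trans order_antisym)
  next
    fix C assume C: "C \<in> Chains (relation_of P S)"
    then have CS: "C \<subseteq> S" and tot: "\<And>q q'. q \<in> C \<Longrightarrow> q' \<in> C \<Longrightarrow> P q q' \<or> P q' q"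
      by (auto simp: Chains_def relation_of_def)
    show "\<exists>u\<in>S. \<forall>q\<in>C. P q u"
    proof (cases "C = {}")
      case True
      have "(\<lambda>f. if f \<in> V then p f else 0) \<in> S"
        using p add scale by (auto simp: S_def sublinear_on_def)
      then show ?thesis using True by blast
    next
      case False
      define u where "u = (\<lambda>f. if f \<in> V then INF q\<in>C. q f else 0)"
      have bdd: "bdd_below ((\<lambda>q. q f) ` C)" if "f \<in> V" for f
        using S_ge[OF _ that] CS by (intro bdd_belowI[of _ "- p (\<lambda>x. - f x)"]) auto
      have u_le: "u f \<le> q f" if "q \<in> C" for f q
        using that bdd CS by (auto simp: u_def S_def intro: cINF_lower)
      have u_ge: "c \<le> u f" if "f \<in> V" "\<And>q. q \<in> C \<Longrightarrow> c \<le> q f" for c f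
        using that False by (auto simp: u_def intro: cINF_greatest)
      have "u \<in> S"
        unfolding S_def sublinear_on_def
      proof (intro CollectI conjI ballI allI impI)
        fix f g assume fg: "f \<in> V" "g \<in> V"
        have 1: "u (\<lambda>x. f x + g x) \<le> q f + q' g" if q: "q \<in> C" "q' \<in> C" for q q'
        proof -
          \<comment> \<open>An infimum of sublinear functionals need not be subadditive; in a chain
            a single \<open>r\<close> serves both summands.\<close>
          obtain r where r: "r \<in> C" "\<And>f. r f \<le> q f" "\<And>f. r f \<le> q' f"
            using tot[OF q] q unfolding P_def by (metis order_refl)
          have "u (\<lambda>x. f x + g x) \<le> r (\<lambda>x. f x + g x)" by (rule u_le[OF r(1)])
          also have "\<dots> \<le> r f + r g" using r(1) CS fg by (auto simp: S_def intro: sublinear_on_add)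
          also have "\<dots> \<le> q f + q' g" by (intro add_mono r)
          finally show ?thesis .
        qed
        have "u (\<lambda>x. f x + g x) - q' g \<le> u f" if "q' \<in> C" for q'
          using 1[OF _ that] by (intro u_ge[OF fg(1)]) (simp add: algebra_simps)
        then have "u (\<lambda>x. f x + g x) - u f \<le> u g"
          by (intro u_ge[OF fg(2)]) (simp add: algebra_simps)
        then show "u (\<lambda>x. f x + g x) \<le> u f + u g" by simp
      next
        fix f and c :: real assume fc: "f \<in> V" "0 < c"
        have "u (\<lambda>x. c * f x) / c \<le> u f"
        proof (rule u_ge[OF fc(1)])
          fix q assume q: "q \<in> C"
          have "u (\<lambda>x. c * f x) \<le> q (\<lambda>x. c * f x)" by (rule u_le[OF q])
          also have "\<dots> \<le> c * q f" using q CS fc by (auto simp: S_def intro: sublinear_on_scale)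
          finally show "u (\<lambda>x. c * f x) / c \<le> q f" using fc by (simp add: field_simps)
        qed
        then show "u (\<lambda>x. c * f x) \<le> c * u f" using fc by (simp add: field_simps)
      next
        fix f assume f: "f \<in> V"
        obtain q where q: "q \<in> C" using False by blast
        have "u f \<le> q f" by (rule u_le[OF q])
        also have "\<dots> \<le> p f" using q CS f by (auto simp: S_def)
        finally show "u f \<le> p f" .
      qed (simp add: u_def)
      then show ?thesis using u_le by (auto simp: P_def)
    qed
  qed
  then obtain q where q: "q \<in> S" and min: "\<And>r. r \<in> S \<Longrightarrow> (\<And>f. r f \<le> q f) \<Longrightarrow> r = q"
    unfolding P_def by blast
  have sub: "sublinear_on V q" and le_p: "\<And>f. f \<in> V \<Longrightarrow> q f \<le> p f" and out: "\<And>f. f \<notin> V \<Longrightarrow> q f = 0"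
    using q by (auto simp: S_def)
  have odd: "q (\<lambda>x. - a x) \<le> - q a" if a: "a \<in> V" for a
  proof -
    have V2: "(\<lambda>x. h x + t * a x) \<in> V" if "h \<in> V" for h t
      using add[OF that scale[OF a, of t]] .
    have ge: "- q (\<lambda>x. - h x) \<le> q (\<lambda>x. h x + t * a x) - t * q a" if h: "h \<in> V" and t: "0 \<le> t" for h t
    proof (cases "t = 0")
      case False
      then have "t * q a = q (\<lambda>x. t * a x)"
        using sublinear_on_scale_eq[OF sub scale a, of t] t by simp
      also have "\<dots> \<le> q (\<lambda>x. h x + t * a x) + q (\<lambda>x. - h x)"
        using sublinear_on_add[OF sub V2[OF h] neg[OF h], of t] by simp
      finally show ?thesis by simp
    qed (use lower[OF sub h] in simp)
    \<comment> \<open>Taking \<open>t = 0\<close> shows \<open>r \<le> q\<close>, and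
      \<open>r\<close> is again in \<open>S\<close>, so minimality forces \<open>r = q\<close>. Then
      \<open>t = 1\<close> at the argument \<open>- a\<close> bounds \<open>q (- a)\<close> by
      \<open>q 0 - q a\<close>.\<close>
    define r where "r = (\<lambda>h. if h \<in> V then INF t\<in>{0..}. q (\<lambda>x. h x + t * a x) - t * q a else 0)"
    have r_le: "r h \<le> q (\<lambda>x. h x + t * a x) - t * q a" if "h \<in> V" "0 \<le> t" for h t
      using that ge[OF that(1)] unfolding r_def
      by (auto intro!: cINF_lower bdd_belowI[of _ "- q (\<lambda>x. - h x)"])
    have r_ge: "c \<le> r h" if "h \<in> V" "\<And>t. 0 \<le> t \<Longrightarrow> c \<le> q (\<lambda>x. h x + t * a x) - t * q a" for c h
      using that by (auto simp: r_def intro: cINF_greatest)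
    have r_le_q: "r h \<le> q h" for h
      using r_le[of h 0] out by (cases "h \<in> V") (auto simp: r_def)
    have "r \<in> S"
      unfolding S_def sublinear_on_def
    proof (intro CollectI conjI ballI allI impI)
      fix f g assume fg: "f \<in> V" "g \<in> V"
      have 1: "r (\<lambda>x. f x + g x) \<le> (q (\<lambda>x. f x + s * a x) - s * q a) + (q (\<lambda>x. g x + t * a x) - t * q a)"
        if "0 \<le> s" "0 \<le> t" for s t
      proof -
        have "r (\<lambda>x. f x + g x) \<le> q (\<lambda>x. f x + g x + (s + t) * a x) - (s + t) * q a"
          using that by (intro r_le add fg) auto
        also have "(\<lambda>x. f x + g x + (s + t) * a x) = (\<lambda>x. (f x + s * a x) + (g x + t * a x))"
          by (simp add: algebra_simps)
        also have "q \<dots> \<le> q (\<lambda>x. f x + s * a x) + q (\<lambda>x. g x + t * a x)"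
          by (intro sublinear_on_add[OF sub] V2 fg)
        finally show ?thesis by (simp add: algebra_simps)
      qed
      have "r (\<lambda>x. f x + g x) - (q (\<lambda>x. g x + t * a x) - t * q a) \<le> r f" if "0 \<le> t" for t
        using 1[OF _ that] by (intro r_ge[OF fg(1)]) (simp add: algebra_simps)
      then have "r (\<lambda>x. f x + g x) - r f \<le> r g"
        by (intro r_ge[OF fg(2)]) (simp add: algebra_simps)
      then show "r (\<lambda>x. f x + g x) \<le> r f + r g" by simp
    next
      fix f and c :: real assume fc: "f \<in> V" "0 < c"
      have "r (\<lambda>x. c * f x) / c \<le> r f"
      proof (rule r_ge[OF fc(1)])
        fix t :: real assume t: "0 \<le> t"
        have "r (\<lambda>x. c * f x) \<le> q (\<lambda>x. c * f x + (c * t) * a x) - (c * t) * q a"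
          using t fc by (intro r_le scale) auto
        also have "(\<lambda>x. c * f x + (c * t) * a x) = (\<lambda>x. c * (f x + t * a x))"
          by (simp add: algebra_simps)
        also have "q \<dots> \<le> c * q (\<lambda>x. f x + t * a x)"
          by (intro sublinear_on_scale[OF sub] V2 fc)
        finally have "r (\<lambda>x. c * f x) \<le> c * (q (\<lambda>x. f x + t * a x) - t * q a)"
          by (simp add: algebra_simps)
        then show "r (\<lambda>x. c * f x) / c \<le> q (\<lambda>x. f x + t * a x) - t * q a"
          using fc by (simp add: field_simps)
      qed
      then show "r (\<lambda>x. c * f x) \<le> c * r f" using fc by (simp add: field_simps)
    next
      fix f assume f: "f \<in> V"
      show "r f \<le> p f" using r_le_q[of f] le_p[OF f] by simp
    qed (simp add: r_def)
    then have "r = q" using r_le_q by (rule min)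
    then have "q (\<lambda>x. - a x) \<le> q (\<lambda>x. - a x + 1 * a x) - 1 * q a"
      using r_le[OF neg[OF a], of 1] by simp
    also have "\<dots> = - q a"
      using sublinear_on_zero[OF sub zero[OF a]] by simp
    finally show ?thesis .
  qed
  show ?thesis
  proof
    show "q f \<le> p f" if "f \<in> V" for f by (rule le_p[OF that])
    show "q (\<lambda>x. f x + g x) = q f + q g" if "f \<in> V" "g \<in> V" for f g
    proof (rule antisym)
      show "q (\<lambda>x. f x + g x) \<le> q f + q g" by (rule sublinear_on_add[OF sub that])
      have "q f \<le> q (\<lambda>x. f x + g x) + q (\<lambda>x. - g x)"
        using sublinear_on_add[OF sub add[OF that] neg[OF that(2)]] by simp
      then show "q f + q g \<le> q (\<lambda>x. f x + g x)" using odd[OF that(2)] by simp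
    qed
    show "q (\<lambda>x. c * f x) = c * q f" if "f \<in> V" "0 < c" for f c
      using sublinear_on_scale_eq[OF sub scale that] .
  qed
qed

subsection \<open>Regularization of finitely additive set functions\<close>

lemma compact_separation:
  fixes K L :: "'a::t2_space set"
  assumes "compact K" "compact L" "K \<inter> L = {}"
  obtains U V where "open U" "open V" "K \<subseteq> U" "L \<subseteq> V" "U \<inter> V = {}"
proof -
  have "Hausdorff_space (euclidean :: 'a topology)"
    unfolding Hausdorff_space_def disjnt_def using hausdorff by auto
  from Hausdorff_space_compact_separation[OF this, of K L] assms that
  show ?thesis by (auto simp: disjnt_def)
qed

locale tight_charge =
  fixes m :: "'b::t2_space set \<Rightarrow> real"
  assumes nonneg: "0 \<le> m A"
    and additive: "A \<inter> B = {} \<Longrightarrow> m (A \<union> B) = m A + m B"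
    and tight: "0 < e \<Longrightarrow> \<exists>K. compact K \<and> m (- K) < e"
begin

lemma empty: "m {} = 0"
  using additive[of "{}" "{}"] by simp

lemma mono: "A \<subseteq> B \<Longrightarrow> m A \<le> m B"
  using additive[of A "B - A"] nonneg[of "B - A"] by (simp add: Un_absorb1)

lemma subadditive: "m (A \<union> B) \<le> m A + m B"
  using additive[of A "B - A"] mono[of "B - A" B] by simp

text \<open>The classical passage from a content on compact sets through inner values of open sets
  to a Caratheodory outer measure. It raises \<open>m\<close> on compact sets
  (\<open>le_content\<close>) and lowers it on open sets (\<open>inner_le\<close> with
  \<open>content_le\<close>).\<close>

definition content :: "'b set \<Rightarrow> real" where
  "content K = (INF U\<in>{U. open U \<and> K \<subseteq> U}. m U)"

definition inner :: "'b set \<Rightarrow> real" where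
  "inner U = (SUP K\<in>{K. compact K \<and> K \<subseteq> U}. content K)"

definition outer :: "'b set \<Rightarrow> real" where
  "outer A = (INF U\<in>{U. open U \<and> A \<subseteq> U}. inner U)"

lemma content_le: "open U \<Longrightarrow> K \<subseteq> U \<Longrightarrow> content K \<le> m U"
  unfolding content_def using nonneg by (intro cINF_lower bdd_belowI[of _ 0]) auto

lemma content_ge: "(\<And>U. open U \<Longrightarrow> K \<subseteq> U \<Longrightarrow> c \<le> m U) \<Longrightarrow> c \<le> content K"
  unfolding content_def by (intro cINF_greatest) auto

lemma le_content: "m K \<le> content K"
  by (intro content_ge mono)

lemma content_mono: "K \<subseteq> L \<Longrightarrow> content K \<le> content L"
  by (intro content_ge content_le) auto

lemma content_subadditive: "content (K \<union> L) \<le> content K + content L"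
proof -
  have 1: "content (K \<union> L) \<le> m U + m V" if "open U" "K \<subseteq> U" "open V" "L \<subseteq> V" for U V
    by (rule order_trans[OF content_le subadditive]) (use that in auto)
  have "content (K \<union> L) - m V \<le> content K" if "open V" "L \<subseteq> V" for V
    using 1[OF _ _ that] by (intro content_ge) (simp add: algebra_simps)
  then have "content (K \<union> L) - content K \<le> content L"
    by (intro content_ge) (simp add: algebra_simps)
  then show ?thesis by simp
qed

text \<open>Disjoint compact sets have disjoint open neighbourhoods in a Hausdorff space, and finite
  additivity of \<open>m\<close> applies to these.\<close>

lemma content_superadditive:
  assumes "compact K" "compact L" "K \<inter> L = {}"
  shows "content K + content L \<le> content (K \<union> L)"
proof (rule content_ge)
  fix W assume W: "open W" "K \<union> L \<subseteq> W"
  obtain U V where UV: "open U" "open V" "K \<subseteq> U" "L \<subseteq> V" "U \<inter> V = {}"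
    using compact_separation[OF assms] by blast
  have "content K + content L \<le> m (W \<inter> U) + m (W \<inter> V)"
    using W UV by (intro add_mono content_le) auto
  also have "\<dots> = m (W \<inter> U \<union> W \<inter> V)" using UV by (intro additive[symmetric]) auto
  also have "\<dots> \<le> m W" by (intro mono) auto
  finally show "content K + content L \<le> m W" .
qed

lemma content_le_inner: "compact K \<Longrightarrow> K \<subseteq> U \<Longrightarrow> content K \<le> inner U"
  unfolding inner_def
  by (rule cSUP_upper) (auto intro!: bdd_aboveI[of _ "m UNIV"] content_le)

lemma inner_le: "(\<And>K. compact K \<Longrightarrow> K \<subseteq> U \<Longrightarrow> content K \<le> c) \<Longrightarrow> inner U \<le> c"
  unfolding inner_def by (intro cSUP_least) auto

lemma inner_mono: "U \<subseteq> V \<Longrightarrow> inner U \<le> inner V"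
  by (intro inner_le content_le_inner) auto

lemma inner_nonneg: "0 \<le> inner U"
  using content_le_inner[of "{}" U] le_content[of "{}"] empty by simp

text \<open>A compact \<open>K \<subseteq> U \<union> V\<close> splits into a compact part in
  \<open>U\<close> and one in \<open>V\<close>: the disjoint compact sets \<open>K - U\<close> and
  \<open>K - V\<close> are separated by open \<open>A\<close> and \<open>B\<close>, and
  \<open>K - A\<close>, \<open>K - B\<close> are the parts.\<close>

lemma inner_subadditive:
  assumes UV: "open U" "open V"
  shows "inner (U \<union> V) \<le> inner U + inner V"
proof (rule inner_le)
  fix K assume K: "compact K" "K \<subseteq> U \<union> V"
  have "(K - U) \<inter> (K - V) = {}" using K by auto
  with K UV obtain A B where AB: "open A" "open B" "K - U \<subseteq> A" "K - V \<subseteq> B" "A \<inter> B = {}"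
    using compact_separation[of "K - U" "K - V"] compact_diff by metis
  have "content K \<le> content ((K - A) \<union> (K - B))" using AB by (intro content_mono) auto
  also have "\<dots> \<le> content (K - A) + content (K - B)" by (rule content_subadditive)
  also have "\<dots> \<le> inner U + inner V"
    using K AB by (intro add_mono content_le_inner compact_diff) auto
  finally show "content K \<le> inner U + inner V" .
qed

lemma inner_UN_le:
  fixes U :: "nat \<Rightarrow> 'b set"
  assumes "\<And>i. open (U i)"
  shows "inner (\<Union>i<N. U i) \<le> (\<Sum>i<N. inner (U i))"
proof (induction N)
  case 0
  show ?case
    by (intro inner_le) (use content_le[of "{}" "{}"] empty in auto)
next
  case (Suc N)
  have "inner (\<Union>i<Suc N. U i) = inner ((\<Union>i<N. U i) \<union> U N)"
    by (simp add: lessThan_Suc Un_commute)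
  also have "\<dots> \<le> inner (\<Union>i<N. U i) + inner (U N)"
    using assms by (intro inner_subadditive) auto
  finally show ?case using Suc by simp
qed

lemma outer_le: "open U \<Longrightarrow> A \<subseteq> U \<Longrightarrow> outer A \<le> inner U"
  unfolding outer_def using inner_nonneg by (intro cINF_lower bdd_belowI[of _ 0]) auto

lemma outer_ge: "(\<And>U. open U \<Longrightarrow> A \<subseteq> U \<Longrightarrow> c \<le> inner U) \<Longrightarrow> c \<le> outer A"
  unfolding outer_def by (intro cINF_greatest) auto

lemma outer_open: "open U \<Longrightarrow> outer U = inner U"
  by (intro antisym outer_le outer_ge inner_mono) auto

lemma outer_mono: "A \<subseteq> B \<Longrightarrow> outer A \<le> outer B"
  by (intro outer_ge outer_le) auto

lemma outer_nonneg: "0 \<le> outer A"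
  by (intro outer_ge inner_nonneg)

lemma outer_approx: "0 < e \<Longrightarrow> \<exists>U. open U \<and> A \<subseteq> U \<and> inner U < outer A + e"
  using outer_ge[of A "outer A + e"] by (meson add_le_same_cancel1 not_less)

lemma le_outer: "compact K \<Longrightarrow> m K \<le> outer K"
  using le_content[of K] by (auto intro!: outer_ge intro: content_le_inner order_trans)

lemma outer_open_le: "open U \<Longrightarrow> outer U \<le> m U"
  by (simp add: outer_open inner_le content_le)

lemma outer_subadditive: "outer (A \<union> B) \<le> outer A + outer B"
proof -
  have 1: "outer (A \<union> B) \<le> inner U + inner V" if "open U" "A \<subseteq> U" "open V" "B \<subseteq> V" for U V
    by (rule order_trans[OF outer_le inner_subadditive]) (use that in auto)
  have "outer (A \<union> B) - inner V \<le> outer A" if "open V" "B \<subseteq> V" for V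
    using 1[OF _ _ that] by (intro outer_ge) (simp add: algebra_simps)
  then have "outer (A \<union> B) - outer A \<le> outer B"
    by (intro outer_ge) (simp add: algebra_simps)
  then show ?thesis by simp
qed

text \<open>Here compactness replaces the countable additivity that \<open>m\<close> need not have:
  inner values see only compact sets, and these are covered by finitely many of the open
  sets.\<close>

lemma outer_countably_subadditive: "ennreal (outer (\<Union>i. A i)) \<le> (\<Sum>i. ennreal (outer (A i)))"
proof (rule ennreal_le_epsilon)
  fix e :: real assume e: "0 < e"
  have "\<forall>i. \<exists>U. open U \<and> A i \<subseteq> U \<and> inner U < outer (A i) + e * (1/2) ^ Suc i"
    using e by (intro allI outer_approx) simp
  then obtain U where U: "\<And>i. open (U i)" "\<And>i. A i \<subseteq> U i"
    "\<And>i. inner (U i) < outer (A i) + e * (1/2) ^ Suc i" by metis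
  define s where "s = (\<Sum>i. ennreal (inner (U i)))"
  have "ennreal (inner (\<Union>i. U i)) \<le> s"
  proof (cases s)
    case (real r)
    have "inner (\<Union>i. U i) \<le> r"
    proof (rule inner_le)
      fix K assume K: "compact K" "K \<subseteq> (\<Union>i. U i)"
      then obtain I where I: "finite I" "K \<subseteq> (\<Union>i\<in>I. U i)"
        using compactE_image[OF K(1), of UNIV U] U(1) by metis
      obtain N where N: "I \<subseteq> {..<N}" using finite_nat_bounded[OF I(1)] by blast
      have "K \<subseteq> (\<Union>i<N. U i)" using I N by blast
      then have "content K \<le> inner (\<Union>i<N. U i)" by (intro content_le_inner K)
      also have "\<dots> \<le> (\<Sum>i<N. inner (U i))" by (rule inner_UN_le[OF U(1)])
      finally have "ennreal (content K) \<le> ennreal (\<Sum>i<N. inner (U i))" by (rule ennreal_leI)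
      also have "\<dots> = (\<Sum>i<N. ennreal (inner (U i)))" using inner_nonneg by simp
      also have "\<dots> \<le> s" unfolding s_def by (rule sum_le_suminf) auto
      finally show "content K \<le> r" using real by simp
    qed
    then show ?thesis using real by (simp add: ennreal_leI)
  qed simp
  then have "ennreal (outer (\<Union>i. A i)) \<le> s"
    using outer_le[of "\<Union>i. U i" "\<Union>i. A i"] U by (meson SUP_mono' ennreal_leI open_UN order_trans)
  also have "s \<le> (\<Sum>i. ennreal (outer (A i)) + ennreal (e * (1/2) ^ Suc i))"
    unfolding s_def using U(3) outer_nonneg e
    by (intro suminf_le) (auto simp flip: ennreal_plus intro!: ennreal_leI less_imp_le)
  also have "\<dots> = (\<Sum>i. ennreal (outer (A i))) + (\<Sum>i. ennreal (e * (1/2) ^ Suc i))"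
    by (rule suminf_add[symmetric]) auto
  also have "(\<Sum>i. ennreal (e * (1/2) ^ Suc i)) = ennreal e"
  proof -
    have "(\<lambda>i. e * (1/2) ^ Suc i) sums (e * 1)" by (intro sums_mult power_half_series)
    then have "(\<lambda>i. ennreal (e * (1/2) ^ Suc i)) sums ennreal e"
      using e by (subst sums_ennreal) auto
    then show ?thesis by (rule sums_unique[symmetric])
  qed
  finally show "ennreal (outer (\<Union>i. A i)) \<le> (\<Sum>i. ennreal (outer (A i))) + ennreal e" .
qed

text \<open>Caratheodory's criterion for open sets. For the nontrivial inequality, exhaust
  \<open>U \<inter> G\<close> by compact \<open>K\<close>; then \<open>G - K\<close> is still open
  and contains \<open>- U \<inter> A\<close>, and a compact \<open>L\<close> inside it is disjoint
  from \<open>K\<close>, so the contents add up below \<open>inner G\<close>.\<close>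

lemma outer_split_open:
  assumes U: "open U"
  shows "outer (U \<inter> A) + outer (- U \<inter> A) = outer A"
proof (rule antisym)
  show "outer A \<le> outer (U \<inter> A) + outer (- U \<inter> A)"
    using outer_subadditive[of "U \<inter> A" "- U \<inter> A"] by (simp flip: Int_Un_distrib2)
  show "outer (U \<inter> A) + outer (- U \<inter> A) \<le> outer A"
  proof (rule outer_ge)
    fix G assume G: "open G" "A \<subseteq> G"
    have "content K + outer (- U \<inter> A) \<le> inner G" if K: "compact K" "K \<subseteq> U \<inter> G" for K
    proof -
      have GK: "open (G - K)" using G K by (simp add: compact_imp_closed open_Diff)
      have "content L \<le> inner G - content K" if L: "compact L" "L \<subseteq> G - K" for L
        using content_superadditive[of K L] content_le_inner[of "K \<union> L" G] K L
        by (force simp: compact_Un)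
      then have "inner (G - K) \<le> inner G - content K" by (rule inner_le)
      moreover have "outer (- U \<inter> A) \<le> inner (G - K)" using G K by (intro outer_le GK) auto
      ultimately show ?thesis by simp
    qed
    then have "inner (U \<inter> G) \<le> inner G - outer (- U \<inter> A)"
      by (intro inner_le) (simp add: algebra_simps)
    moreover have "outer (U \<inter> A) \<le> inner (U \<inter> G)" using U G by (intro outer_le) auto
    ultimately show "outer (U \<inter> A) + outer (- U \<inter> A) \<le> inner G" by simp
  qed
qed

text \<open>Inner regularity by closed sets is the outer approximation of the complement by open
  sets, which is built into \<open>outer\<close>. Tightness is inherited from \<open>m\<close>
  because the complement of a compact set is open.\<close>

theorem radon_measure_exists:
  obtains \<pi> where "radon_measure \<pi>"
    "\<forall>U. open U \<longrightarrow> measure \<pi> U \<le> m U" "\<forall>K. compact K \<longrightarrow> m K \<le> measure \<pi> K"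
proof -
  define f where "f A = ennreal (outer A)" for A
  define \<pi> where "\<pi> = measure_of UNIV (sets borel) f"
  have "outer {} = 0" using outer_open_le[of "{}"] outer_nonneg[of "{}"] empty by simp
  then have oms: "outer_measure_space (Pow UNIV) f"
    unfolding outer_measure_space_def positive_def increasing_def countably_subadditive_def f_def
    by (auto intro: outer_countably_subadditive ennreal_leI outer_mono)
  interpret P: sigma_algebra UNIV "Pow UNIV :: 'b set set" by (rule sigma_algebra_Pow)
  have ms: "measure_space UNIV (lambda_system UNIV (Pow UNIV) f) f"
    by (rule P.caratheodory_lemma[OF oms])
  have sub: "sets borel \<subseteq> lambda_system UNIV (Pow UNIV) f"
    unfolding borel_def
  proof (subst sets_measure_of)
    show "sigma_sets UNIV {S. open S} \<subseteq> lambda_system UNIV (Pow UNIV) f"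
    proof (rule sigma_algebra.sigma_sets_subset)
      show "sigma_algebra UNIV (lambda_system UNIV (Pow UNIV) f)"
        using ms by (simp add: measure_space_def)
      show "{S. open S} \<subseteq> lambda_system UNIV (Pow UNIV) f"
        using outer_split_open outer_nonneg
        by (auto simp: lambda_system_def f_def simp flip: ennreal_plus Compl_eq_Diff_UNIV)
    qed
  qed simp
  have "sigma_algebra UNIV (sets (borel :: 'b measure))"
    using sets.sigma_algebra_axioms[of "borel :: 'b measure"] by simp
  from measure_down[OF ms this sub]
  have em: "emeasure \<pi> A = ennreal (outer A)" if "A \<in> sets borel" for A
    unfolding \<pi>_def using emeasure_measure_of_sigma[of UNIV "sets borel" f A] that
    by (simp add: measure_space_def f_def)
  have sets [simp]: "sets \<pi> = sets borel"
    unfolding \<pi>_def using sets.sigma_sets_eq[of borel] by (subst sets_measure_of) auto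
  have space [simp]: "space \<pi> = UNIV" using sets_eq_imp_space_eq[OF sets] by simp
  have me: "measure \<pi> A = outer A" if "A \<in> sets borel" for A
    using em[OF that] outer_nonneg by (simp add: measure_def)
  have fin: "finite_measure \<pi>" by (intro finite_measureI) (simp add: em)
  show ?thesis
  proof
    show "\<forall>U. open U \<longrightarrow> measure \<pi> U \<le> m U" by (simp add: me outer_open_le)
    show "\<forall>K. compact K \<longrightarrow> m K \<le> measure \<pi> K" by (simp add: me le_outer borel_compact)
    show "radon_measure \<pi>"
      unfolding radon_measure_def
    proof (intro conjI ballI allI impI sets fin)
      fix B :: "'b set" and e :: real assume B: "B \<in> sets borel" and e: "0 < e"
      obtain U where U: "open U" "- B \<subseteq> U" "inner U < outer (- B) + e"
        using outer_approx[OF e] by blast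
      have "measure \<pi> (B - (- U)) = measure \<pi> (U - (- B))" by (rule arg_cong[of _ _ "measure \<pi>"]) auto
      also have "\<dots> = measure \<pi> U - measure \<pi> (- B)"
        using U B finite_measure.finite_measure_Diff[OF fin, of U "- B"]
        by (auto simp: Compl_eq_Diff_UNIV)
      also have "\<dots> < e" using U B by (simp add: me outer_open Compl_eq_Diff_UNIV)
      finally show "\<exists>F. closed F \<and> F \<subseteq> B \<and> measure \<pi> (B - F) < e"
        using U by (intro exI[of _ "- U"]) auto
    next
      fix e :: real assume "0 < e"
      then obtain K where K: "compact K" "m (- K) < e" using tight by blast
      have "measure \<pi> (- K) \<le> m (- K)"
        using K compact_imp_closed[of K] by (simp add: me outer_open_le open_Compl)
      then show "\<exists>K. compact K \<and> K \<in> sets \<pi> \<and> measure \<pi> (UNIV - K) < e"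
        using K by (intro exI[of _ K]) (auto simp: borel_compact simp flip: Compl_eq_Diff_UNIV)
    qed
  qed
qed

end

subsection \<open>Radon measures and the dual bound\<close>

lemma radon_measure_sets: "radon_measure M \<Longrightarrow> sets M = sets borel"
  by (simp add: radon_measure_def)

lemma radon_measure_finite: "radon_measure M \<Longrightarrow> finite_measure M"
  by (simp add: radon_measure_def)

lemma radon_measure_space: "radon_measure M \<Longrightarrow> space M = UNIV"
  using sets_eq_imp_space_eq[OF radon_measure_sets] by simp

lemma radon_measure_measurable:
  "radon_measure M \<Longrightarrow> measurable M N = measurable borel N"
  by (intro measurable_cong_sets radon_measure_sets) auto

lemma radon_measure_closed_inner:
  "radon_measure M \<Longrightarrow> B \<in> sets borel \<Longrightarrow> 0 < e \<Longrightarrow>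
    \<exists>F. closed F \<and> F \<subseteq> B \<and> measure M (B - F) < e"
  unfolding radon_measure_def by blast

lemma radon_measure_integrable_bounded:
  fixes f :: "'a::topological_space \<Rightarrow> real"
  assumes "radon_measure M" "f \<in> borel_measurable borel" "\<And>x. \<bar>f x\<bar> \<le> C"
  shows "integrable M f"
  using assms by (intro finite_measure.integrable_const_bound[of M f C])
    (auto simp: radon_measure_finite radon_measure_measurable)

lemma radon_measure_tight:
  fixes M :: "'a::t2_space measure"
  assumes "radon_measure M" "0 < e"
  obtains K where "compact K" "measure M (- K) < e"
  using assms unfolding radon_measure_def by (auto simp: Compl_eq_Diff_UNIV)

lemma radon_measure_compact_inner:
  fixes M :: "'a::t2_space measure"
  assumes M: "radon_measure M" and B: "B \<in> sets borel" and e: "0 < e"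
  obtains K where "compact K" "K \<subseteq> B" "measure M (B - K) < e"
proof -
  interpret finite_measure M by (rule radon_measure_finite[OF M])
  obtain F where F: "closed F" "F \<subseteq> B" "measure M (B - F) < e / 2"
    using radon_measure_closed_inner[OF M B, of "e/2"] e by auto
  obtain L where L: "compact L" "measure M (- L) < e / 2"
    using radon_measure_tight[OF M, of "e/2"] e by auto
  have bor: "B - F \<in> sets M" "- L \<in> sets M"
    using B F L compact_imp_closed[of L] by (auto simp: radon_measure_sets[OF M])
  have "measure M (B - L \<inter> F) \<le> measure M ((B - F) \<union> - L)"
    using bor by (intro finite_measure_mono) auto
  also have "\<dots> \<le> measure M (B - F) + measure M (- L)"
    using bor by (intro measure_Un_le)
  also have "\<dots> < e" using F L by simp
  finally show ?thesis
    using F L that[of "L \<inter> F"] by (auto intro: compact_Int_closed)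
qed

text \<open>Turns \<phi> into finitely many demands of the kind the insertion theorem accepts. The
  range is cut into bands of height \<open>h\<close> and each band shrunk to a closed set; a
  function meeting the demands falls below \<phi> by at most \<open>h\<close>, except on a small
  remainder, where the demand \<open>- C\<close> on \<open>UNIV\<close> limits the fall to
  \<open>2 * C\<close>.\<close>

lemma radon_measure_closed_minorant:
  fixes \<phi> :: "'a::topological_space \<Rightarrow> real"
  assumes M: "radon_measure M" "prob_space M"
    and \<phi>: "\<phi> \<in> borel_measurable borel" "\<And>x. \<bar>\<phi> x\<bar> \<le> C" and C: "0 < C" and e: "0 < e"
  obtains \<L> :: "(real \<times> 'a set) set" where "finite \<L>" "(- C, UNIV) \<in> \<L>"
    "\<And>t A. (t, A) \<in> \<L> \<Longrightarrow> closed A" "\<And>t A x. (t, A) \<in> \<L> \<Longrightarrow> x \<in> A \<Longrightarrow> t \<le> \<phi> x"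
    "\<And>f. integrable M f \<Longrightarrow> (\<And>t A x. (t, A) \<in> \<L> \<Longrightarrow> x \<in> A \<Longrightarrow> t \<le> f x) \<Longrightarrow>
      (\<integral>x. \<phi> x \<partial>M) \<le> (\<integral>x. f x \<partial>M) + e"
proof -
  interpret prob_space M by fact
  define h where "h = e / 2"
  have h: "0 < h" using e by (simp add: h_def)
  \<comment> \<open>The bands 0 to \<open>n\<close> cover \<open>[- C, C]\<close>. There are
    \<open>n + 1\<close> remainders of measure below \<open>\<delta>\<close>, and
    \<open>2 * C\<close> times their total is at most \<open>h\<close>, half of the error
    \<open>e\<close>.\<close>
  define n where "n = nat \<lceil>2 * C / h\<rceil>"
  define \<delta> where "\<delta> = h / (2 * C * (real n + 1))"
  have \<delta>: "0 < \<delta>" using h C by (simp add: \<delta>_def)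
  define B where "B = (\<lambda>i::nat. {x. - C + real i * h \<le> \<phi> x \<and> \<phi> x < - C + (real i + 1) * h})"
  have B: "B i \<in> sets borel" for i
    using \<phi>(1) unfolding B_def by measurable
  have "\<forall>i. \<exists>F. closed F \<and> F \<subseteq> B i \<and> measure M (B i - F) < \<delta>"
    using radon_measure_closed_inner[OF M(1) B \<delta>] by blast
  then obtain F where F: "\<And>i. closed (F i)" "\<And>i. F i \<subseteq> B i" "\<And>i. measure M (B i - F i) < \<delta>"
    by metis
  define E where "E = (\<Union>i\<le>n. B i - F i)"
  have E: "E \<in> sets M" "B i - F i \<in> sets M" for i
    using B F(1) unfolding E_def radon_measure_sets[OF M(1)] by auto
  have "measure M E \<le> (\<Sum>i\<le>n. measure M (B i - F i))"
    unfolding E_def using E by (intro finite_measure_subadditive_finite) auto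
  also have "\<dots> \<le> (\<Sum>i\<le>n. \<delta>)" using F(3) by (intro sum_mono less_imp_le) auto
  also have "\<dots> = (real n + 1) * \<delta>" by simp
  also have "\<dots> = h / (2 * C)"
    unfolding \<delta>_def using nonzero_mult_divide_mult_cancel_right[of "real n + 1" h "2 * C"] by (simp add: ac_simps)
  finally have ME: "2 * C * measure M E \<le> h" using C by (simp add: field_simps)
  define \<L> where "\<L> = insert (- C, UNIV) ((\<lambda>i. (- C + real i * h, F i)) ` {..n})"
  show ?thesis
  proof
    show "finite \<L>" "(- C, UNIV) \<in> \<L>" by (auto simp: \<L>_def)
    show "closed A" if "(t, A) \<in> \<L>" for t A using that F(1) by (auto simp: \<L>_def)
    show "t \<le> \<phi> x" if "(t, A) \<in> \<L>" "x \<in> A" for t A x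
      using that F(2) \<phi>(2)[of x] by (auto simp: \<L>_def B_def)
    fix f assume f: "integrable M f" "\<And>t A x. (t, A) \<in> \<L> \<Longrightarrow> x \<in> A \<Longrightarrow> t \<le> f x"
    have f_ge: "- C \<le> f x" for x using f(2)[of "- C" UNIV x] by (simp add: \<L>_def)
    have pt: "\<phi> x \<le> f x + h + 2 * C * indicator E x" for x
    proof -
      define i where "i = nat \<lfloor>(\<phi> x + C) / h\<rfloor>"
      have nn: "0 \<le> (\<phi> x + C) / h" using \<phi>(2)[of x] h by (simp add: abs_le_iff)
      then have i: "real i \<le> (\<phi> x + C) / h" "(\<phi> x + C) / h < real i + 1"
        by (auto simp: i_def)
      then have xB: "x \<in> B i" using h by (simp add: B_def field_simps)
      have "(\<phi> x + C) / h \<le> 2 * C / h" using \<phi>(2)[of x] h by (intro divide_right_mono) (auto simp: abs_le_iff)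
      then have "i \<le> n" unfolding i_def n_def by (intro nat_mono) linarith
      show ?thesis
      proof (cases "x \<in> F i")
        case True
        then have "- C + real i * h \<le> f x"
          using \<open>i \<le> n\<close> by (intro f(2)[of _ "F i"]) (auto simp: \<L>_def)
        moreover have "\<phi> x < - C + real i * h + h" using xB by (simp add: B_def algebra_simps)
        moreover have "0 \<le> 2 * C * indicator E x" using C by simp
        ultimately show ?thesis by linarith
      next
        case False
        then have "x \<in> E" using xB \<open>i \<le> n\<close> by (auto simp: E_def)
        then show ?thesis using f_ge[of x] \<phi>(2)[of x] h by (simp add: abs_le_iff)
      qed
    qed
    have "(\<integral>x. \<phi> x \<partial>M) \<le> (\<integral>x. f x + h + 2 * C * indicator E x \<partial>M)"
      using f(1) E(1) pt radon_measure_integrable_bounded[OF M(1) \<phi>]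
      by (intro integral_mono) (auto simp: less_top[symmetric])
    also have "\<dots> = (\<integral>x. f x \<partial>M) + h + 2 * C * measure M E"
      using f(1) E(1) by (simp add: prob_space less_top[symmetric])
    also have "\<dots> \<le> (\<integral>x. f x \<partial>M) + e" using ME by (simp add: h_def)
    finally show "(\<integral>x. \<phi> x \<partial>M) \<le> (\<integral>x. f x \<partial>M) + e" .
  qed
qed

text \<open>The inequality for the complement is the reverse inequality for the set, as the total
  masses agree.\<close>

lemma prob_space_eqI_le:
  assumes "prob_space M" "prob_space N" and sets: "sets M = sets N"
    and le: "\<And>A. A \<in> sets M \<Longrightarrow> measure M A \<le> measure N A"
  shows "M = N"
proof -
  interpret M: prob_space M by fact
  interpret N: prob_space N by fact
  show ?thesis
  proof (rule measure_eqI[OF sets])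
    fix A assume A: "A \<in> sets M"
    have "measure M (space M - A) \<le> measure N (space N - A)"
      using le[OF sets.compl_sets[OF A]] sets_eq_imp_space_eq[OF sets] by simp
    then have "measure N A \<le> measure M A"
      using A sets by (simp add: M.prob_compl N.prob_compl)
    then show "emeasure M A = emeasure N A"
      using le[OF A] by (simp add: M.emeasure_eq_measure N.emeasure_eq_measure)
  qed
qed

text \<open>The sum counts the integers from 1 to \<open>n\<close> below \<open>y\<close>: a
  staircase that trails \<open>y\<close> by at most 1 until its steps are used up. It serves to
  approximate the cost by indicators of superlevel sets.\<close>

lemma sum_less_indicator_bounds:
  fixes y :: real
  assumes "0 \<le> y"
  defines "s n \<equiv> \<Sum>k=1..n. if real k < y then 1 else (0::real)"
  shows "s n \<le> y" "y - 1 \<le> s n \<or> s n = real n"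
proof -
  have "s n \<le> y \<and> s n \<le> real n \<and> (y - 1 \<le> s n \<or> s n = real n)"
  proof (induction n)
    case (Suc n)
    have "s (Suc n) = s n + (if real (Suc n) < y then 1 else 0)" by (simp add: s_def)
    then show ?case using Suc by auto
  qed (use assms in \<open>simp add: s_def\<close>)
  then show "s n \<le> y" "y - 1 \<le> s n \<or> s n = real n" by auto
qed

section \<open>The dual problem and its extension to bounded Borel pairs\<close>

locale transport_problem = closed_nbd_metric d
  for d :: "'a::t4_space \<Rightarrow> 'a \<Rightarrow> real" +
  fixes \<mu> \<nu> :: "'a measure"
  assumes mu: "radon_measure \<mu>" "prob_space \<mu>" "finite_first_moment d \<mu>"
    and nu: "radon_measure \<nu>" "prob_space \<nu>" "finite_first_moment d \<nu>"
begin

abbreviation dist2 :: "'a \<times> 'a \<Rightarrow> real" where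
  "dist2 p \<equiv> d (fst p) (snd p)"

lemma dist2_measurable [measurable]: "dist2 \<in> borel_measurable borel"
  unfolding borel_measurable_iff_greater using open_dist_greater by auto

lemma dist_measurable [measurable]: "d x \<in> borel_measurable borel"
proof -
  have "continuous_on UNIV (\<lambda>y. (x, y))" by (intro continuous_intros)
  then have "(\<lambda>y. (x, y)) \<in> borel \<rightarrow>\<^sub>M borel" by (rule borel_measurable_continuous_onI)
  from measurable_compose[OF this dist2_measurable] show ?thesis by simp
qed

lemma integrable_dist:
  assumes "radon_measure M" "prob_space M" "finite_first_moment d M"
  shows "integrable M (d x)"
proof -
  interpret prob_space M by fact
  obtain x0 where x0: "(\<integral>\<^sup>+ y. ennreal (d y x0) \<partial>M) < \<infinity>"
    using assms by (auto simp: finite_first_moment_def)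
  have "integrable M (d x0)"
    using x0 by (intro integrableI_bounded) (auto simp: radon_measure_measurable[OF assms(1)] commute)
  then have int: "integrable M (\<lambda>y. d x x0 + d x0 y)" by simp
  show ?thesis
    by (rule Bochner_Integration.integrable_bound[OF int])
      (use triangle in \<open>auto simp: radon_measure_measurable[OF assms(1)]\<close>)
qed

lemma lipschitz_integrable:
  assumes M: "radon_measure M" "prob_space M" "finite_first_moment d M"
    and f: "f \<in> borel_measurable borel" "\<And>x y. \<bar>f x - f y\<bar> \<le> d x y"
  shows "integrable M f"
proof -
  interpret prob_space M by fact
  \<comment> \<open>\<open>undefined\<close> is an arbitrary base point, also in the moment bounds
    below.\<close>
  have int: "integrable M (\<lambda>y. \<bar>f undefined\<bar> + d undefined y)"
    using integrable_dist[OF M] by simp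
  show ?thesis
  proof (rule Bochner_Integration.integrable_bound[OF int])
    show "f \<in> borel_measurable M" using f by (simp add: radon_measure_measurable[OF M(1)])
    have "\<bar>f y\<bar> \<le> \<bar>f undefined\<bar> + d undefined y" for y
      using f(2)[of undefined y] by simp
    then show "AE y in M. norm (f y) \<le> norm (\<bar>f undefined\<bar> + d undefined y)"
      by (intro AE_I2) (simp add: abs_of_nonneg)
  qed
qed

definition dual_value :: "('a \<Rightarrow> real) \<Rightarrow> real" where
  "dual_value f = (\<integral>x. f x \<partial>\<mu>) - (\<integral>x. f x \<partial>\<nu>)"

text \<open>A supremum in the reals is legitimate because the first moments bound all dual values,
  and the zero function is a competitor.\<close>

definition dual_sup :: real where
  "dual_sup = (SUP f\<in>continuous_lipschitz1 d. dual_value f)"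

lemma continuous_lipschitz1D:
  assumes "f \<in> continuous_lipschitz1 d"
  shows "f \<in> borel_measurable borel" "\<And>x y. \<bar>f x - f y\<bar> \<le> d x y"
  using assms by (auto simp: continuous_lipschitz1_def borel_measurable_continuous_onI)

lemma dual_value_le_moments:
  assumes f: "f \<in> borel_measurable borel" "\<And>x y. \<bar>f x - f y\<bar> \<le> d x y"
  shows "dual_value f \<le> (\<integral>x. d undefined x \<partial>\<mu>) + (\<integral>x. d undefined x \<partial>\<nu>)"
proof -
  interpret \<mu>: prob_space \<mu> by (rule mu)
  interpret \<nu>: prob_space \<nu> by (rule nu)
  have "(\<integral>x. f x \<partial>\<mu>) \<le> (\<integral>x. f undefined + d undefined x \<partial>\<mu>)"
    using f(2)[of undefined] lipschitz_integrable[OF mu f] integrable_dist[OF mu]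
    by (intro integral_mono) (auto simp: abs_le_iff algebra_simps)
  moreover have "(\<integral>x. f undefined - d undefined x \<partial>\<nu>) \<le> (\<integral>x. f x \<partial>\<nu>)"
    using f(2)[of undefined] lipschitz_integrable[OF nu f] integrable_dist[OF nu]
    by (intro integral_mono) (auto simp: abs_le_iff algebra_simps)
  ultimately show ?thesis
    using integrable_dist[OF mu] integrable_dist[OF nu]
    by (simp add: dual_value_def \<mu>.prob_space \<nu>.prob_space)
qed

lemma bdd_above_dual_value: "bdd_above (dual_value ` continuous_lipschitz1 d)"
  by (rule bdd_aboveI2) (rule dual_value_le_moments[OF continuous_lipschitz1D])

lemma dual_value_le_sup: "f \<in> continuous_lipschitz1 d \<Longrightarrow> dual_value f \<le> dual_sup"
  unfolding dual_sup_def by (rule cSUP_upper[OF _ bdd_above_dual_value])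

lemma zero_continuous_lipschitz1: "(\<lambda>x. 0) \<in> continuous_lipschitz1 d"
  by (simp add: continuous_lipschitz1_def)

lemma dual_sup_nonneg: "0 \<le> dual_sup"
  using dual_value_le_sup[OF zero_continuous_lipschitz1] by (simp add: dual_value_def)

definition bounded_borel :: "('a \<Rightarrow> real) \<Rightarrow> bool" where
  "bounded_borel \<phi> \<longleftrightarrow> \<phi> \<in> borel_measurable borel \<and> bounded (range \<phi>)"

lemma bounded_borelE:
  assumes "bounded_borel \<phi>"
  obtains C where "\<And>x. \<bar>\<phi> x\<bar> \<le> C"
  using assms by (auto simp: bounded_borel_def bounded_iff)

lemma bounded_borel_integrable:
  assumes "bounded_borel \<phi>"
  shows "integrable \<mu> \<phi>" "integrable \<nu> \<phi>"
proof -
  obtain C where "\<And>x. \<bar>\<phi> x\<bar> \<le> C" using bounded_borelE[OF assms] by blast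
  then show "integrable \<mu> \<phi>" "integrable \<nu> \<phi>"
    using assms mu nu by (auto intro!: radon_measure_integrable_bounded simp: bounded_borel_def)
qed

lemma bounded_borelI: "\<phi> \<in> borel_measurable borel \<Longrightarrow> (\<And>x. \<bar>\<phi> x\<bar> \<le> C) \<Longrightarrow> bounded_borel \<phi>"
  by (auto simp: bounded_borel_def bounded_iff)

lemma bounded_borel_add:
  assumes "bounded_borel \<phi>" "bounded_borel \<psi>"
  shows "bounded_borel (\<lambda>x. \<phi> x + \<psi> x)"
  using assms by (auto simp: bounded_borel_def intro: bounded_plus_comp)

lemma bounded_borel_scale:
  assumes "bounded_borel \<phi>"
  shows "bounded_borel (\<lambda>x. c * \<phi> x)"
proof -
  obtain C where C: "\<And>x. \<bar>\<phi> x\<bar> \<le> C" using bounded_borelE[OF assms] by blast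
  then have "\<bar>c * \<phi> x\<bar> \<le> \<bar>c\<bar> * C" for x by (simp add: abs_mult mult_left_mono)
  then show ?thesis using assms by (intro bounded_borelI) (auto simp: bounded_borel_def)
qed

lemma bounded_borel_const: "bounded_borel (\<lambda>x. c)"
  by (rule bounded_borelI[of _ "\<bar>c\<bar>"]) auto

text \<open>A single \<open>f\<close> is sought with \<open>\<phi> \<le> f\<close> and
  \<open>f \<le> - \<psi>\<close> up to small error: the demands for \<psi> change sign and become
  upper demands. The inequality between \<phi>, \<psi> and \<open>d\<close> is exactly the distance
  condition of the insertion theorem. The competitor in the dual problem is
  \<open>\<kappa> * f\<close>, and \<kappa> tends to 1.\<close>

lemma bounded_borel_dual_le:
  assumes \<phi>: "bounded_borel \<phi>" and \<psi>: "bounded_borel \<psi>"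
    and le: "\<And>x y. \<phi> x + \<psi> y \<le> d x y"
  shows "(\<integral>x. \<phi> x \<partial>\<mu>) + (\<integral>x. \<psi> x \<partial>\<nu>) \<le> dual_sup"
proof (rule field_le_epsilon)
  fix e :: real assume e: "0 < e"
  interpret \<mu>: prob_space \<mu> by (rule mu)
  interpret \<nu>: prob_space \<nu> by (rule nu)
  obtain C1 C2 where C12: "\<And>x. \<bar>\<phi> x\<bar> \<le> C1" "\<And>x. \<bar>\<psi> x\<bar> \<le> C2"
    using bounded_borelE \<phi> \<psi> by metis
  define C where "C = max 1 (max C1 C2)"
  have C: "0 < C" "\<And>x. \<bar>\<phi> x\<bar> \<le> C" "\<And>x. \<bar>\<psi> x\<bar> \<le> C"
    using C12 by (auto simp: C_def le_max_iff_disj)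
  have meas: "\<phi> \<in> borel_measurable borel" "\<psi> \<in> borel_measurable borel"
    using \<phi> \<psi> by (auto simp: bounded_borel_def)
  have e2: "0 < e / 2" using e by simp
  obtain \<L> where L: "finite \<L>" "(- C, UNIV) \<in> \<L>"
    "\<And>t A. (t, A) \<in> \<L> \<Longrightarrow> closed A" "\<And>t A x. (t, A) \<in> \<L> \<Longrightarrow> x \<in> A \<Longrightarrow> t \<le> \<phi> x"
    "\<And>f. integrable \<mu> f \<Longrightarrow> (\<And>t A x. (t, A) \<in> \<L> \<Longrightarrow> x \<in> A \<Longrightarrow> t \<le> f x) \<Longrightarrow>
      (\<integral>x. \<phi> x \<partial>\<mu>) \<le> (\<integral>x. f x \<partial>\<mu>) + e / 2"
    using radon_measure_closed_minorant[OF mu(1,2) meas(1) C(2,1) e2] by metis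
  obtain \<L>' where L': "finite \<L>'" "(- C, UNIV) \<in> \<L>'"
    "\<And>t A. (t, A) \<in> \<L>' \<Longrightarrow> closed A" "\<And>t A x. (t, A) \<in> \<L>' \<Longrightarrow> x \<in> A \<Longrightarrow> t \<le> \<psi> x"
    "\<And>f. integrable \<nu> f \<Longrightarrow> (\<And>t A x. (t, A) \<in> \<L>' \<Longrightarrow> x \<in> A \<Longrightarrow> t \<le> f x) \<Longrightarrow>
      (\<integral>x. \<psi> x \<partial>\<nu>) \<le> (\<integral>x. f x \<partial>\<nu>) + e / 2"
    using radon_measure_closed_minorant[OF nu(1,2) meas(2) C(3,1) e2] by metis
  define \<U> where "\<U> = (\<lambda>(t, A). (- t, A)) ` \<L>'"
  have U: "(s, B) \<in> \<U> \<longleftrightarrow> (- s, B) \<in> \<L>'" for s B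
    by (force simp: \<U>_def)
  have "(\<integral>x. \<phi> x \<partial>\<mu>) + (\<integral>x. \<psi> x \<partial>\<nu>) - e \<le> dual_sup"
  proof (rule field_le_mult_one_interval)
    fix \<kappa> :: real assume \<kappa>: "0 < \<kappa>" "\<kappa> < 1"
    obtain f where f: "continuous_on UNIV f" "\<And>x y. \<kappa> * \<bar>f x - f y\<bar> \<le> d x y"
      "\<And>t A x. (t, A) \<in> \<L> \<Longrightarrow> x \<in> A \<Longrightarrow> t \<le> f x"
      "\<And>s B x. (s, B) \<in> \<U> \<Longrightarrow> x \<in> B \<Longrightarrow> f x \<le> s"
    proof (rule insertion_continuous_lipschitz[of \<L> \<U> "- C" C \<kappa>])
      show "finite \<L>" "finite \<U>" "(- C, UNIV) \<in> \<L>" "(C, UNIV) \<in> \<U>"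
        using L L' U by (auto simp: \<U>_def)
      show "closed A" if "(t, A) \<in> \<L>" for t A using L that by blast
      show "closed A" if "(t, A) \<in> \<U>" for t A using L' U that by blast
      show "t - s \<le> d x y" if "(t, A) \<in> \<L>" "(s, B) \<in> \<U>" "x \<in> A" "y \<in> B" for t A s B x y
        using L(4)[of t A x] L'(4)[of "- s" B y] le[of x y] that by (simp add: U)
    qed (use \<kappa> in blast)+
    have bd: "\<bar>f x\<bar> \<le> C" for x
      using f(3)[OF L(2), of x] f(4)[of C UNIV x] L'(2) by (simp add: U abs_le_iff)
    have int: "integrable \<mu> f" "integrable \<nu> f"
      using bd f(1) mu nu by (auto intro!: radon_measure_integrable_bounded borel_measurable_continuous_onI)
    have "(\<integral>x. \<phi> x \<partial>\<mu>) \<le> (\<integral>x. f x \<partial>\<mu>) + e / 2"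
      by (rule L(5)) (use int f(3) in auto)
    moreover have "(\<integral>x. \<psi> x \<partial>\<nu>) \<le> (\<integral>x. - f x \<partial>\<nu>) + e / 2"
    proof (rule L'(5))
      fix t A x assume "(t, A) \<in> \<L>'" "x \<in> A"
      then show "t \<le> - f x" using f(4)[of "- t" A x] U by simp
    qed (use int in auto)
    ultimately have "(\<integral>x. \<phi> x \<partial>\<mu>) + (\<integral>x. \<psi> x \<partial>\<nu>) - e \<le> dual_value f"
      using int by (simp add: dual_value_def)
    then have "\<kappa> * ((\<integral>x. \<phi> x \<partial>\<mu>) + (\<integral>x. \<psi> x \<partial>\<nu>) - e) \<le> \<kappa> * dual_value f"
      using \<kappa> by simp
    also have "\<dots> = dual_value (\<lambda>x. \<kappa> * f x)"
      by (simp add: dual_value_def algebra_simps)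
    also have "\<dots> \<le> dual_sup"
    proof (rule dual_value_le_sup)
      have "\<bar>\<kappa> * f x - \<kappa> * f y\<bar> = \<kappa> * \<bar>f x - f y\<bar>" for x y
        using \<kappa> by (simp add: abs_mult flip: right_diff_distrib)
      then show "(\<lambda>x. \<kappa> * f x) \<in> continuous_lipschitz1 d"
        using f(1,2) by (auto simp: continuous_lipschitz1_def intro!: continuous_intros)
    qed
    finally show "\<kappa> * ((\<integral>x. \<phi> x \<partial>\<mu>) + (\<integral>x. \<psi> x \<partial>\<nu>) - e) \<le> dual_sup" .
  qed
  then show "(\<integral>x. \<phi> x \<partial>\<mu>) + (\<integral>x. \<psi> x \<partial>\<nu>) \<le> dual_sup + e" by simp
qed

subsection \<open>Existence of an optimal coupling\<close>

text \<open>No measurability is asked, so a functional on this space assigns a mass to every subset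
  of the product. An unbounded \<open>d\<close> is not a member; it enters only as a
  majorant.\<close>

definition bounded_on_pairs :: "('a \<times> 'a \<Rightarrow> real) set" where
  "bounded_on_pairs = {h. bounded (range h)}"

text \<open>Prices of majorants of \<open>h\<close>: functions of one coordinate are priced by the
  marginals, \<open>d\<close> is priced at \<open>dual_sup\<close>. A linear functional below the
  least price has the right marginals and cost at most \<open>dual_sup\<close>, so one sublinear
  functional encodes both requirements.\<close>

definition dual_costs :: "('a \<times> 'a \<Rightarrow> real) \<Rightarrow> real set" where
  "dual_costs h = {(\<integral>x. \<phi> x \<partial>\<mu>) + (\<integral>x. \<psi> x \<partial>\<nu>) + t * dual_sup | \<phi> \<psi> t.
     bounded_borel \<phi> \<and> bounded_borel \<psi> \<and> 0 \<le> t \<and> (\<forall>x y. h (x, y) \<le> \<phi> x + \<psi> y + t * d x y)}"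

definition dual_majorant :: "('a \<times> 'a \<Rightarrow> real) \<Rightarrow> real" where
  "dual_majorant h = Inf (dual_costs h)"

lemma dual_costsI:
  assumes "bounded_borel \<phi>" "bounded_borel \<psi>" "0 \<le> t"
    "\<And>x y. h (x, y) \<le> \<phi> x + \<psi> y + t * d x y"
  shows "(\<integral>x. \<phi> x \<partial>\<mu>) + (\<integral>x. \<psi> x \<partial>\<nu>) + t * dual_sup \<in> dual_costs h"
  using assms unfolding dual_costs_def by blast

lemma dual_costsE:
  assumes "v \<in> dual_costs h"
  obtains \<phi> \<psi> t where "v = (\<integral>x. \<phi> x \<partial>\<mu>) + (\<integral>x. \<psi> x \<partial>\<nu>) + t * dual_sup"
    "bounded_borel \<phi>" "bounded_borel \<psi>" "0 \<le> t"
    "\<forall>x y. h (x, y) \<le> \<phi> x + \<psi> y + t * d x y"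
  using assms unfolding dual_costs_def by blast

text \<open>No majorant of a constant is priced below it, so the infimum of the prices is finite.
  For \<open>t > 0\<close>, division by \<open>t\<close> reduces this to the dual bound for bounded
  Borel pairs; for \<open>t = 0\<close> the inequality is integrated in one variable after the
  other.\<close>

lemma dual_cost_ge:
  assumes \<phi>: "bounded_borel \<phi>" and \<psi>: "bounded_borel \<psi>" and t: "0 \<le> t"
    and le: "\<And>x y. a \<le> \<phi> x + \<psi> y + t * d x y"
  shows "a \<le> (\<integral>x. \<phi> x \<partial>\<mu>) + (\<integral>x. \<psi> x \<partial>\<nu>) + t * dual_sup"
proof -
  interpret \<mu>: prob_space \<mu> by (rule mu)
  interpret \<nu>: prob_space \<nu> by (rule nu)
  note int = bounded_borel_integrable[OF \<phi>] bounded_borel_integrable[OF \<psi>]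
  show ?thesis
  proof (cases "t = 0")
    case True
    have "a - \<psi> y \<le> (\<integral>x. \<phi> x \<partial>\<mu>)" for y
    proof -
      have "(\<integral>x. a - \<psi> y \<partial>\<mu>) \<le> (\<integral>x. \<phi> x \<partial>\<mu>)"
        using le[of _ y] True int by (intro integral_mono) (auto simp: algebra_simps)
      then show ?thesis by (simp add: \<mu>.prob_space)
    qed
    then have "(\<integral>y. a - (\<integral>x. \<phi> x \<partial>\<mu>) \<partial>\<nu>) \<le> (\<integral>y. \<psi> y \<partial>\<nu>)"
      using int by (intro integral_mono) (auto simp: algebra_simps)
    then show ?thesis using True by (simp add: \<nu>.prob_space)
  next
    case False
    then have t: "0 < t" using t by simp
    have "(\<integral>x. (1 / t) * (a + (- 1) * \<phi> x) \<partial>\<mu>) + (\<integral>y. (- 1 / t) * \<psi> y \<partial>\<nu>) \<le> dual_sup"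
    proof (rule bounded_borel_dual_le)
      show "bounded_borel (\<lambda>x. (1 / t) * (a + (- 1) * \<phi> x))" "bounded_borel (\<lambda>y. (- 1 / t) * \<psi> y)"
        by (intro bounded_borel_scale bounded_borel_add bounded_borel_const \<phi> \<psi>)+
      fix x y
      have "(a - \<phi> x - \<psi> y) / t \<le> d x y"
        using le[of x y] t by (simp add: pos_divide_le_eq algebra_simps)
      then show "(1 / t) * (a + (- 1) * \<phi> x) + (- 1 / t) * \<psi> y \<le> d x y"
        by (simp add: diff_divide_distrib)
    qed
    then have "(a - (\<integral>x. \<phi> x \<partial>\<mu>) - (\<integral>y. \<psi> y \<partial>\<nu>)) / t \<le> dual_sup"
      using int by (simp add: \<mu>.prob_space diff_divide_distrib)
    then show ?thesis using t by (simp add: pos_divide_le_eq algebra_simps)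
  qed
qed

lemma bdd_below_dual_costs:
  assumes "h \<in> bounded_on_pairs"
  shows "bdd_below (dual_costs h)"
proof -
  obtain C where C: "\<And>p. \<bar>h p\<bar> \<le> C"
    using assms by (auto simp: bounded_on_pairs_def bounded_iff)
  show ?thesis
  proof (rule bdd_belowI)
    fix v assume "v \<in> dual_costs h"
    then obtain \<phi> \<psi> t where *: "v = (\<integral>x. \<phi> x \<partial>\<mu>) + (\<integral>x. \<psi> x \<partial>\<nu>) + t * dual_sup"
      "bounded_borel \<phi>" "bounded_borel \<psi>" "0 \<le> t" "\<forall>x y. h (x, y) \<le> \<phi> x + \<psi> y + t * d x y"
      by (rule dual_costsE)
    have "- C \<le> \<phi> x + \<psi> y + t * d x y" for x y
      using C[of "(x, y)"] *(5)[rule_format, of x y] by (simp add: abs_le_iff)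
    from dual_cost_ge[OF *(2-4) this] show "- C \<le> v" by (simp add: *(1))
  qed
qed

lemma dual_costs_nonempty:
  assumes "h \<in> bounded_on_pairs"
  shows "dual_costs h \<noteq> {}"
proof -
  obtain C where C: "\<And>p. \<bar>h p\<bar> \<le> C"
    using assms by (auto simp: bounded_on_pairs_def bounded_iff)
  then have "h (x, y) \<le> C + 0 + 0 * d x y" for x y by (simp add: abs_le_iff)
  from dual_costsI[OF bounded_borel_const bounded_borel_const order_refl this] show ?thesis by blast
qed

lemma dual_majorant_le:
  assumes "h \<in> bounded_on_pairs" "bounded_borel \<phi>" "bounded_borel \<psi>" "0 \<le> t"
    "\<And>x y. h (x, y) \<le> \<phi> x + \<psi> y + t * d x y"
  shows "dual_majorant h \<le> (\<integral>x. \<phi> x \<partial>\<mu>) + (\<integral>x. \<psi> x \<partial>\<nu>) + t * dual_sup"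
  unfolding dual_majorant_def
  by (intro cInf_lower dual_costsI bdd_below_dual_costs assms)

lemma bounded_on_pairs_add:
  "f \<in> bounded_on_pairs \<Longrightarrow> g \<in> bounded_on_pairs \<Longrightarrow> (\<lambda>p. f p + g p) \<in> bounded_on_pairs"
  by (auto simp: bounded_on_pairs_def intro: bounded_plus_comp)

lemma bounded_on_pairsI: "(\<And>p. \<bar>h p\<bar> \<le> C) \<Longrightarrow> h \<in> bounded_on_pairs"
  by (auto simp: bounded_on_pairs_def bounded_iff)

lemma bounded_on_pairs_scale:
  assumes "h \<in> bounded_on_pairs"
  shows "(\<lambda>p. c * h p) \<in> bounded_on_pairs"
proof -
  obtain C where C: "\<And>p. \<bar>h p\<bar> \<le> C"
    using assms by (auto simp: bounded_on_pairs_def bounded_iff)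
  show ?thesis
    by (rule bounded_on_pairsI[of _ "\<bar>c\<bar> * C"]) (simp add: abs_mult C mult_left_mono)
qed

lemma sublinear_dual_majorant: "sublinear_on bounded_on_pairs dual_majorant"
  unfolding sublinear_on_def
proof (intro conjI ballI allI impI)
  fix f g assume fg: "f \<in> bounded_on_pairs" "g \<in> bounded_on_pairs"
  have 1: "dual_majorant (\<lambda>p. f p + g p) \<le> v + w" if vw: "v \<in> dual_costs f" "w \<in> dual_costs g" for v w
  proof -
    obtain \<phi> \<psi> t where v: "v = (\<integral>x. \<phi> x \<partial>\<mu>) + (\<integral>x. \<psi> x \<partial>\<nu>) + t * dual_sup"
      "bounded_borel \<phi>" "bounded_borel \<psi>" "0 \<le> t" "\<forall>x y. f (x, y) \<le> \<phi> x + \<psi> y + t * d x y"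
      using vw(1) by (rule dual_costsE)
    obtain \<phi>' \<psi>' t' where w: "w = (\<integral>x. \<phi>' x \<partial>\<mu>) + (\<integral>x. \<psi>' x \<partial>\<nu>) + t' * dual_sup"
      "bounded_borel \<phi>'" "bounded_borel \<psi>'" "0 \<le> t'" "\<forall>x y. g (x, y) \<le> \<phi>' x + \<psi>' y + t' * d x y"
      using vw(2) by (rule dual_costsE)
    have "dual_majorant (\<lambda>p. f p + g p) \<le>
      (\<integral>x. \<phi> x + \<phi>' x \<partial>\<mu>) + (\<integral>x. \<psi> x + \<psi>' x \<partial>\<nu>) + (t + t') * dual_sup"
    proof (intro dual_majorant_le bounded_on_pairs_add bounded_borel_add fg v w)
      show "f (x, y) + g (x, y) \<le> \<phi> x + \<phi>' x + (\<psi> y + \<psi>' y) + (t + t') * d x y" for x y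
        using v(5)[rule_format, of x y] w(5)[rule_format, of x y] by (simp add: algebra_simps)
    qed (use v w in auto)
    also have "\<dots> = v + w"
      using v w by (simp add: bounded_borel_integrable algebra_simps)
    finally show ?thesis .
  qed
  have "dual_majorant (\<lambda>p. f p + g p) - w \<le> dual_majorant f" if "w \<in> dual_costs g" for w
    unfolding dual_majorant_def[of f] using 1[OF _ that] dual_costs_nonempty[OF fg(1)]
    by (intro cInf_greatest) (auto simp: algebra_simps)
  then have "dual_majorant (\<lambda>p. f p + g p) - dual_majorant f \<le> dual_majorant g"
    unfolding dual_majorant_def[of g] using dual_costs_nonempty[OF fg(2)]
    by (intro cInf_greatest) (auto simp: algebra_simps)
  then show "dual_majorant (\<lambda>p. f p + g p) \<le> dual_majorant f + dual_majorant g" by simp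
next
  fix f and c :: real assume f: "f \<in> bounded_on_pairs" and c: "0 < c"
  have "dual_majorant (\<lambda>p. c * f p) / c \<le> dual_majorant f"
    unfolding dual_majorant_def[of f]
  proof (rule cInf_greatest[OF dual_costs_nonempty[OF f]])
    fix v assume "v \<in> dual_costs f"
    then obtain \<phi> \<psi> t where v: "v = (\<integral>x. \<phi> x \<partial>\<mu>) + (\<integral>x. \<psi> x \<partial>\<nu>) + t * dual_sup"
      "bounded_borel \<phi>" "bounded_borel \<psi>" "0 \<le> t" "\<forall>x y. f (x, y) \<le> \<phi> x + \<psi> y + t * d x y"
      by (rule dual_costsE)
    have "dual_majorant (\<lambda>p. c * f p) \<le>
      (\<integral>x. c * \<phi> x \<partial>\<mu>) + (\<integral>x. c * \<psi> x \<partial>\<nu>) + (c * t) * dual_sup"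
    proof (intro dual_majorant_le bounded_on_pairs_scale bounded_borel_scale f v)
      show "c * f (x, y) \<le> c * \<phi> x + c * \<psi> y + (c * t) * d x y" for x y
        using mult_left_mono[OF v(5)[rule_format, of x y], of c] c by (simp add: algebra_simps)
    qed (use v c in auto)
    also have "\<dots> = c * v" by (simp add: v(1) algebra_simps)
    finally show "dual_majorant (\<lambda>p. c * f p) / c \<le> v" using c by (simp add: field_simps)
  qed
  then show "dual_majorant (\<lambda>p. c * f p) \<le> c * dual_majorant f" using c by (simp add: field_simps)
qed

text \<open>Each property is the bound by \<open>dual_majorant\<close> tested on one explicit
  majorant; lower bounds come from \<open>- f\<close>. Upper bounds for the marginals suffice, since
  the total mass is 1.\<close>

lemma finitely_additive_plan:
  obtains \<Lambda> :: "('a \<times> 'a \<Rightarrow> real) \<Rightarrow> real" where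
    "\<forall>f\<in>bounded_on_pairs. \<forall>g\<in>bounded_on_pairs. \<Lambda> (\<lambda>p. f p + g p) = \<Lambda> f + \<Lambda> g"
    "\<forall>f\<in>bounded_on_pairs. \<forall>c>0. \<Lambda> (\<lambda>p. c * f p) = c * \<Lambda> f"
    "\<forall>f\<in>bounded_on_pairs. (\<forall>p. 0 \<le> f p) \<longrightarrow> 0 \<le> \<Lambda> f"
    "\<Lambda> (indicator UNIV) = 1"
    "\<forall>A\<in>sets borel. \<Lambda> (indicator (A \<times> UNIV)) \<le> measure \<mu> A"
    "\<forall>B\<in>sets borel. \<Lambda> (indicator (UNIV \<times> B)) \<le> measure \<nu> B"
    "\<forall>f\<in>bounded_on_pairs. (\<forall>p. f p \<le> dist2 p) \<longrightarrow> \<Lambda> f \<le> dual_sup"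
proof -
  interpret \<mu>: prob_space \<mu> by (rule mu)
  interpret \<nu>: prob_space \<nu> by (rule nu)
  obtain \<Lambda> where L: "\<And>f. f \<in> bounded_on_pairs \<Longrightarrow> \<Lambda> f \<le> dual_majorant f"
    "\<And>f g. f \<in> bounded_on_pairs \<Longrightarrow> g \<in> bounded_on_pairs \<Longrightarrow> \<Lambda> (\<lambda>p. f p + g p) = \<Lambda> f + \<Lambda> g"
    "\<And>f c. f \<in> bounded_on_pairs \<Longrightarrow> 0 < c \<Longrightarrow> \<Lambda> (\<lambda>p. c * f p) = c * \<Lambda> f"
    by (rule Hahn_Banach_functions[OF bounded_on_pairs_add bounded_on_pairs_scale sublinear_dual_majorant]) blast+
  have le: "\<Lambda> h \<le> (\<integral>x. \<phi> x \<partial>\<mu>) + (\<integral>x. \<psi> x \<partial>\<nu>) + t * dual_sup"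
    if "h \<in> bounded_on_pairs" "bounded_borel \<phi>" "bounded_borel \<psi>" "0 \<le> t"
      "\<And>x y. h (x, y) \<le> \<phi> x + \<psi> y + t * d x y" for h \<phi> \<psi> t
    using L(1)[OF that(1)] dual_majorant_le[OF that] by simp
  have ind: "indicator A \<in> bounded_on_pairs" for A
    by (rule bounded_on_pairsI[of _ 1]) (simp add: indicator_def)
  have bind: "bounded_borel (indicator A)" if "A \<in> sets borel" for A
    using that by (intro bounded_borelI[of _ 1]) (auto simp: indicator_def)
  have zero: "\<Lambda> (\<lambda>p. 0) = 0"
    using L(2)[of "\<lambda>p. 0" "\<lambda>p. 0"] bounded_on_pairsI[of "\<lambda>p. 0" 0] by simp
  have neg: "\<Lambda> (\<lambda>p. - f p) = - \<Lambda> f" if "f \<in> bounded_on_pairs" for f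
    using L(2)[OF that, of "\<lambda>p. - f p"] bounded_on_pairs_scale[OF that, of "-1"] zero by simp
  show ?thesis
  proof (rule that[of \<Lambda>]; (intro ballI allI impI)?)
    show "\<Lambda> (\<lambda>p. f p + g p) = \<Lambda> f + \<Lambda> g" if "f \<in> bounded_on_pairs" "g \<in> bounded_on_pairs" for f g
      by (rule L(2)[OF that])
    show "\<Lambda> (\<lambda>p. c * f p) = c * \<Lambda> f" if "f \<in> bounded_on_pairs" "0 < c" for f c
      by (rule L(3)[OF that])
    show "0 \<le> \<Lambda> f" if "f \<in> bounded_on_pairs" "\<forall>p. 0 \<le> f p" for f
      using le[of "\<lambda>p. - f p" "\<lambda>_. 0" "\<lambda>_. 0" 0] neg[OF that(1)] that bounded_borel_const
        bounded_on_pairs_scale[OF that(1), of "-1"] by simp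
    show "\<Lambda> (indicator UNIV) = 1"
    proof (rule antisym)
      show "\<Lambda> (indicator UNIV) \<le> 1"
        using le[OF ind, of "\<lambda>_. 1" "\<lambda>_. 0" 0 UNIV] bounded_borel_const by (simp add: \<mu>.prob_space)
      show "1 \<le> \<Lambda> (indicator UNIV)"
        using le[of "\<lambda>p. - indicator UNIV p" "\<lambda>_. - 1" "\<lambda>_. 0" 0] neg[OF ind, of UNIV] bounded_borel_const
          bounded_on_pairs_scale[OF ind, of "-1" UNIV] by (simp add: \<mu>.prob_space)
    qed
    show "\<Lambda> (indicator (A \<times> UNIV)) \<le> measure \<mu> A" if "A \<in> sets borel" for A
      using le[OF ind, of "indicator A" "\<lambda>_. 0" 0 "A \<times> UNIV"] bounded_borel_const bind[OF that] that
      by (simp add: indicator_times radon_measure_sets[OF mu(1)])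
    show "\<Lambda> (indicator (UNIV \<times> B)) \<le> measure \<nu> B" if "B \<in> sets borel" for B
      using le[OF ind, of "\<lambda>_. 0" "indicator B" 0 "UNIV \<times> B"] bounded_borel_const bind[OF that] that
      by (simp add: indicator_times radon_measure_sets[OF nu(1)])
    show "\<Lambda> f \<le> dual_sup" if "f \<in> bounded_on_pairs" "\<forall>p. f p \<le> dist2 p" for f
      using le[OF that(1), of "\<lambda>_. 0" "\<lambda>_. 0" 1] that(2) bounded_borel_const by force
  qed
qed

section \<open>Integrals against couplings and weak duality\<close>

lemma coupling_measurable:
  assumes "\<pi> \<in> couplings \<mu> \<nu>"
  shows "fst \<in> \<pi> \<rightarrow>\<^sub>M borel" "snd \<in> \<pi> \<rightarrow>\<^sub>M borel"
  using assms
  by (auto simp: couplings_def radon_measure_measurable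
      intro!: borel_measurable_continuous_onI continuous_intros)

lemma coupling_integral:
  fixes f :: "'a \<Rightarrow> real"
  assumes \<pi>: "\<pi> \<in> couplings \<mu> \<nu>" and f: "f \<in> borel_measurable borel"
  shows "(\<integral>x. f x \<partial>\<mu>) = (\<integral>p. f (fst p) \<partial>\<pi>)" "(\<integral>x. f x \<partial>\<nu>) = (\<integral>p. f (snd p) \<partial>\<pi>)"
    "integrable \<mu> f \<Longrightarrow> integrable \<pi> (\<lambda>p. f (fst p))"
    "integrable \<nu> f \<Longrightarrow> integrable \<pi> (\<lambda>p. f (snd p))"
proof -
  have *: "distr \<pi> borel fst = \<mu>" "distr \<pi> borel snd = \<nu>" using \<pi> by (auto simp: couplings_def)
  note m = coupling_measurable[OF \<pi>]
  show "(\<integral>x. f x \<partial>\<mu>) = (\<integral>p. f (fst p) \<partial>\<pi>)" "(\<integral>x. f x \<partial>\<nu>) = (\<integral>p. f (snd p) \<partial>\<pi>)"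
    using integral_distr[OF m(1) f] integral_distr[OF m(2) f] by (simp_all add: *)
  show "integrable \<mu> f \<Longrightarrow> integrable \<pi> (\<lambda>p. f (fst p))"
    "integrable \<nu> f \<Longrightarrow> integrable \<pi> (\<lambda>p. f (snd p))"
    using integrable_distr_eq[OF m(1) f] integrable_distr_eq[OF m(2) f] by (simp_all add: *)
qed

text \<open>The triangle inequality through a base point makes the cost of every coupling finite, so
  optimality can be discussed with real integrals.\<close>

lemma coupling_integrable_dist2:
  assumes \<pi>: "\<pi> \<in> couplings \<mu> \<nu>"
  shows "integrable \<pi> dist2"
proof (rule Bochner_Integration.integrable_bound)
  show "integrable \<pi> (\<lambda>p. d undefined (fst p) + d undefined (snd p))"
    using coupling_integral(3,4)[OF \<pi> dist_measurable] integrable_dist[OF mu] integrable_dist[OF nu] by simp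
  show "dist2 \<in> borel_measurable \<pi>"
    using \<pi> dist2_measurable by (auto simp: couplings_def radon_measure_measurable)
  have "dist2 p \<le> d undefined (fst p) + d undefined (snd p)" for p
    using triangle[of "fst p" undefined "snd p"] commute[of "fst p" undefined] by simp
  then show "AE p in \<pi>. norm (dist2 p) \<le> norm (d undefined (fst p) + d undefined (snd p))"
    by (intro AE_I2) (simp add: abs_of_nonneg)
qed

lemma transport_cost_eq:
  assumes "\<pi> \<in> couplings \<mu> \<nu>"
  shows "transport_cost d \<pi> = ennreal (\<integral>p. dist2 p \<partial>\<pi>)"
  unfolding transport_cost_def
  by (rule nn_integral_eq_integral[OF coupling_integrable_dist2[OF assms]]) simp

lemma dual_value_coupling:
  assumes \<pi>: "\<pi> \<in> couplings \<mu> \<nu>"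
    and f: "f \<in> borel_measurable borel" "\<And>x y. \<bar>f x - f y\<bar> \<le> d x y"
  shows "integrable \<pi> (\<lambda>p. f (fst p) - f (snd p))"
    "dual_value f = (\<integral>p. f (fst p) - f (snd p) \<partial>\<pi>)"
    "dual_value f \<le> (\<integral>p. dist2 p \<partial>\<pi>)"
proof -
  have int: "integrable \<pi> (\<lambda>p. f (fst p))" "integrable \<pi> (\<lambda>p. f (snd p))"
    using coupling_integral(3,4)[OF \<pi> f(1)] lipschitz_integrable[OF mu f] lipschitz_integrable[OF nu f]
    by auto
  then show i: "integrable \<pi> (\<lambda>p. f (fst p) - f (snd p))" by simp
  show eq: "dual_value f = (\<integral>p. f (fst p) - f (snd p) \<partial>\<pi>)"
    using int by (simp add: dual_value_def coupling_integral(1,2)[OF \<pi> f(1)])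
  have "f (fst p) - f (snd p) \<le> dist2 p" for p using f(2)[of "fst p" "snd p"] by simp
  then show "dual_value f \<le> (\<integral>p. dist2 p \<partial>\<pi>)"
    unfolding eq by (intro integral_mono i coupling_integrable_dist2[OF \<pi>])
qed

lemma dual_sup_le_cost:
  assumes "\<pi> \<in> couplings \<mu> \<nu>"
  shows "dual_sup \<le> (\<integral>p. dist2 p \<partial>\<pi>)"
  unfolding dual_sup_def
proof (rule cSUP_least)
  show "continuous_lipschitz1 d \<noteq> {}" using zero_continuous_lipschitz1 by blast
  show "dual_value f \<le> (\<integral>p. dist2 p \<partial>\<pi>)" if "f \<in> continuous_lipschitz1 d" for f
    using continuous_lipschitz1D[OF that] by (rule dual_value_coupling(3)[OF assms])
qed

theorem optimal_coupling_exists: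
  obtains \<pi> where "\<pi> \<in> couplings \<mu> \<nu>" "transport_cost d \<pi> \<le> ennreal dual_sup"
proof -
  interpret \<mu>: prob_space \<mu> by (rule mu)
  interpret \<nu>: prob_space \<nu> by (rule nu)
  obtain \<Lambda> :: "('a \<times> 'a \<Rightarrow> real) \<Rightarrow> real" where
    L_add: "\<forall>f\<in>bounded_on_pairs. \<forall>g\<in>bounded_on_pairs. \<Lambda> (\<lambda>p. f p + g p) = \<Lambda> f + \<Lambda> g" and
    L_scale: "\<forall>f\<in>bounded_on_pairs. \<forall>c>0. \<Lambda> (\<lambda>p. c * f p) = c * \<Lambda> f" and
    L_nonneg: "\<forall>f\<in>bounded_on_pairs. (\<forall>p. 0 \<le> f p) \<longrightarrow> 0 \<le> \<Lambda> f" and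
    L_one: "\<Lambda> (indicator UNIV) = 1" and
    L_fst: "\<forall>A\<in>sets borel. \<Lambda> (indicator (A \<times> UNIV)) \<le> measure \<mu> A" and
    L_snd: "\<forall>B\<in>sets borel. \<Lambda> (indicator (UNIV \<times> B)) \<le> measure \<nu> B" and
    L_cost: "\<forall>f\<in>bounded_on_pairs. (\<forall>p. f p \<le> dist2 p) \<longrightarrow> \<Lambda> f \<le> dual_sup"
    by (rule finitely_additive_plan)
  note L_add = L_add[rule_format] and L_scale = L_scale[rule_format] and L_nonneg = L_nonneg[rule_format]
    and L_fst = L_fst[rule_format] and L_snd = L_snd[rule_format] and L_cost = L_cost[rule_format]
  define m where "m A = \<Lambda> (indicator A)" for A
  have ind: "indicator A \<in> bounded_on_pairs" for A
    by (rule bounded_on_pairsI[of _ 1]) (simp add: indicator_def)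
  have m_nonneg: "0 \<le> m A" for A unfolding m_def by (intro L_nonneg ind) simp
  have m_add: "m (A \<union> B) = m A + m B" if "A \<inter> B = {}" for A B
  proof -
    have "(indicator (A \<union> B) :: _ \<Rightarrow> real) = (\<lambda>p. indicator A p + indicator B p)"
      using that by (auto simp: indicator_def fun_eq_iff)
    then show ?thesis unfolding m_def by (simp add: L_add ind)
  qed
  have m_compl: "m (- (K \<times> L)) \<le> measure \<mu> (- K) + measure \<nu> (- L)" if "closed K" "closed L" for K L
  proof -
    have "m (- (K \<times> L)) = m ((- K) \<times> UNIV \<union> K \<times> (- L))" by (rule arg_cong[of _ _ m]) auto
    also have "\<dots> = m ((- K) \<times> UNIV) + m (K \<times> (- L))" by (rule m_add) auto
    also have "m (K \<times> (- L)) \<le> m (UNIV \<times> (- L))"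
    proof -
      have "K \<times> (- L) \<inter> (- K) \<times> (- L) = {}" by auto
      from m_add[OF this] show ?thesis
        using m_nonneg[of "(- K) \<times> (- L)"] by (simp flip: Sigma_Un_distrib1)
    qed
    also have "m ((- K) \<times> UNIV) + m (UNIV \<times> (- L)) \<le> measure \<mu> (- K) + measure \<nu> (- L)"
      unfolding m_def using that by (intro add_mono L_fst L_snd) auto
    finally show ?thesis by simp
  qed
  \<comment> \<open>This form of the marginal conditions survives regularization: for compact
    \<open>K\<close> and \<open>L\<close> the mass of the rectangle can only grow.\<close>
  have m_rect: "1 - measure \<mu> (- K) - measure \<nu> (- L) \<le> m (K \<times> L)" if "closed K" "closed L" for K L
    using m_compl[OF that] m_add[of "K \<times> L" "- (K \<times> L)"] L_one by (simp add: m_def)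
  interpret m: tight_charge m
  proof
    fix e :: real assume "0 < e"
    then have e: "0 < e / 2" by simp
    obtain K where K: "compact K" "measure \<mu> (- K) < e / 2" by (rule radon_measure_tight[OF mu(1) e])
    obtain L where L: "compact L" "measure \<nu> (- L) < e / 2" by (rule radon_measure_tight[OF nu(1) e])
    have "m (- (K \<times> L)) < e"
      using m_compl[of K L] K L by (simp add: compact_imp_closed)
    then show "\<exists>K. compact K \<and> m (- K) < e" using K L by (blast intro: compact_Times)
  qed (use m_nonneg m_add in auto)
  obtain \<pi> where \<pi>: "radon_measure \<pi>"
    and open_le: "\<forall>U. open U \<longrightarrow> measure \<pi> U \<le> m U"
    and compact_ge: "\<forall>K. compact K \<longrightarrow> m K \<le> measure \<pi> K"
    by (rule m.radon_measure_exists)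
  note open_le = open_le[rule_format] and compact_ge = compact_ge[rule_format]
  interpret fin: finite_measure \<pi> by (rule radon_measure_finite[OF \<pi>])
  have sets [measurable_cong]: "sets \<pi> = sets borel" by (rule radon_measure_sets[OF \<pi>])
  have space: "space \<pi> = UNIV" by (rule radon_measure_space[OF \<pi>])
  have fst: "fst \<in> \<pi> \<rightarrow>\<^sub>M borel" and snd: "snd \<in> \<pi> \<rightarrow>\<^sub>M borel"
    by (auto simp: radon_measure_measurable[OF \<pi>]
      intro!: borel_measurable_continuous_onI continuous_intros)
  have rect: "1 - measure \<mu> (- K) - measure \<nu> (- L) \<le> measure \<pi> (K \<times> L)" if "compact K" "compact L" for K L
    using m_rect[of K L] compact_ge[OF compact_Times[OF that]] that by (simp add: compact_imp_closed)
  have rect_sets: "K \<times> L \<in> sets \<pi>" if "compact K" "compact L" for K L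
    unfolding sets using that by (intro borel_compact compact_Times)
  \<comment> \<open>One inequality is enough, because both measures will have total mass 1. It is
    tested on \<open>K \<times> L\<close> with \<open>K\<close> nearly filling \<open>A\<close> and
    \<open>L\<close> nearly filling the space.\<close>
  have marg1: "measure \<mu> A \<le> measure \<pi> (fst -` A)" if A: "A \<in> sets borel" for A
  proof (rule field_le_epsilon)
    fix e :: real assume "0 < e"
    then have e: "0 < e / 2" by simp
    obtain K where K: "compact K" "K \<subseteq> A" "measure \<mu> (A - K) < e / 2"
      by (rule radon_measure_compact_inner[OF mu(1) A e])
    obtain L where L: "compact L" "measure \<nu> (- L) < e / 2" by (rule radon_measure_tight[OF nu(1) e])
    have "measure \<mu> A - measure \<mu> K < e / 2"
      using K A by (subst (asm) \<mu>.finite_measure_Diff) (auto simp: radon_measure_sets[OF mu(1)] borel_compact)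
    moreover have "measure \<mu> (- K) = 1 - measure \<mu> K"
      using \<mu>.prob_compl[of K] K by (simp add: radon_measure_sets[OF mu(1)] radon_measure_space[OF mu(1)] borel_compact Compl_eq_Diff_UNIV)
    moreover have "measure \<pi> (K \<times> L) \<le> measure \<pi> (fst -` A)"
      using K L measurable_sets[OF fst A] by (intro fin.finite_measure_mono) (auto simp: space)
    ultimately show "measure \<mu> A \<le> measure \<pi> (fst -` A) + e"
      using rect[OF K(1) L(1)] L by linarith
  qed
  have marg2: "measure \<nu> A \<le> measure \<pi> (snd -` A)" if A: "A \<in> sets borel" for A
  proof (rule field_le_epsilon)
    fix e :: real assume "0 < e"
    then have e: "0 < e / 2" by simp
    obtain K where K: "compact K" "K \<subseteq> A" "measure \<nu> (A - K) < e / 2"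
      by (rule radon_measure_compact_inner[OF nu(1) A e])
    obtain L where L: "compact L" "measure \<mu> (- L) < e / 2" by (rule radon_measure_tight[OF mu(1) e])
    have "measure \<nu> A - measure \<nu> K < e / 2"
      using K A by (subst (asm) \<nu>.finite_measure_Diff) (auto simp: radon_measure_sets[OF nu(1)] borel_compact)
    moreover have "measure \<nu> (- K) = 1 - measure \<nu> K"
      using \<nu>.prob_compl[of K] K by (simp add: radon_measure_sets[OF nu(1)] radon_measure_space[OF nu(1)] borel_compact Compl_eq_Diff_UNIV)
    moreover have "measure \<pi> (L \<times> K) \<le> measure \<pi> (snd -` A)"
      using K L measurable_sets[OF snd A] by (intro fin.finite_measure_mono) (auto simp: space)
    ultimately show "measure \<nu> A \<le> measure \<pi> (snd -` A) + e"
      using rect[OF L(1) K(1)] L by linarith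
  qed
  have "measure \<pi> UNIV = 1"
  proof (rule antisym)
    show "measure \<pi> UNIV \<le> 1" using open_le[of UNIV] L_one by (simp add: m_def)
    show "1 \<le> measure \<pi> UNIV"
      using marg1[of UNIV] \<mu>.prob_space by (simp add: radon_measure_space[OF mu(1)])
  qed
  then interpret \<pi>: prob_space \<pi>
    by (intro prob_spaceI) (simp add: fin.emeasure_eq_measure space)
  have "\<mu> = distr \<pi> borel fst"
    by (rule prob_space_eqI_le[OF mu(2) \<pi>.prob_space_distr[OF fst]])
      (auto simp: radon_measure_sets[OF mu(1)] measure_distr fst marg1 space)
  moreover have "\<nu> = distr \<pi> borel snd"
    by (rule prob_space_eqI_le[OF nu(2) \<pi>.prob_space_distr[OF snd]])
      (auto simp: radon_measure_sets[OF nu(1)] measure_distr snd marg2 space)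
  ultimately have coupling: "\<pi> \<in> couplings \<mu> \<nu>"
    using \<pi> \<pi>.prob_space_axioms by (simp add: couplings_def)

  \<comment> \<open>\<open>u N\<close> is a staircase below \<open>dist2\<close> with steps
    \<open>1 / (N + 1)\<close> up to height \<open>N + 1\<close>. It is a positive combination of
    indicators of open sets, on which \<pi> is at most \<open>m\<close>; hence its integral is at
    most \<open>\<Lambda> (u N)\<close>.\<close>
  define U where "U N k = {p. real k / real (Suc N) < dist2 p}" for N k :: nat
  define u where "u N p = (1 / real (Suc N)) * (\<Sum>k=1..Suc N * Suc N. indicator (U N k) p)" for N p
  have U: "open (U N k)" for N k unfolding U_def by (rule open_dist_greater)
  have U_sets: "U N k \<in> sets \<pi>" for N k using U sets by auto
  have u_bound: "u N p \<le> dist2 p" "dist2 p - 1 / real (Suc N) \<le> u N p \<or> u N p = real (Suc N)" for N p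
  proof -
    have s: "(\<Sum>k=1..n. indicator (U N k) p) =
      (\<Sum>k=1..n. if real k < real (Suc N) * dist2 p then 1 else (0::real))" for n
      by (intro sum.cong) (auto simp: U_def indicator_def field_simps)
    have nn: "0 \<le> real (Suc N) * dist2 p" by simp
    note b = sum_less_indicator_bounds[OF nn, of "Suc N * Suc N", folded s]
    define R where "R = real (Suc N)"
    define S where "S = (\<Sum>k=1..Suc N * Suc N. indicator (U N k) p :: real)"
    have R: "0 < R" "u N p = S / R" by (simp_all add: R_def S_def u_def)
    have "S \<le> R * dist2 p" "R * dist2 p - 1 \<le> S \<or> S = R * R"
      using b by (simp_all only: R_def S_def of_nat_mult)
    moreover have "dist2 p - 1 / R = (R * dist2 p - 1) / R"
      using R(1) by (simp add: diff_divide_distrib)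
    ultimately show "u N p \<le> dist2 p" "dist2 p - 1 / real (Suc N) \<le> u N p \<or> u N p = real (Suc N)"
      unfolding R_def[symmetric] R(2) using R(1)
      by (auto simp: pos_divide_le_eq mult.commute intro: divide_right_mono)
  qed
  have u_nonneg: "0 \<le> u N p" for N p unfolding u_def by (intro mult_nonneg_nonneg sum_nonneg) auto
  have sum_L: "(\<lambda>p. \<Sum>k=1..n. indicator (U N k) p) \<in> bounded_on_pairs \<and>
      \<Lambda> (\<lambda>p. \<Sum>k=1..n. indicator (U N k) p) = (\<Sum>k=1..n. m (U N k))" for N n
  proof (induction n)
    case 0
    have "(\<lambda>p. 0) = (indicator {} :: 'a \<times> 'a \<Rightarrow> real)" by auto
    then show ?case using ind[of "{}"] m.empty by (simp add: m_def)
  next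
    case (Suc n)
    then show ?case
      using L_add[of "\<lambda>p. \<Sum>k=1..n. indicator (U N k) p" "indicator (U N (Suc n))"] ind
        bounded_on_pairs_add[of "\<lambda>p. \<Sum>k=1..n. indicator (U N k) p" "indicator (U N (Suc n))"]
      by (simp add: m_def)
  qed
  have u_integrable: "integrable \<pi> (u N)" for N
    unfolding u_def using U_sets fin.emeasure_finite by (auto simp: less_top[symmetric])
  have u_int: "(\<integral>\<^sup>+p. ennreal (u N p) \<partial>\<pi>) \<le> ennreal dual_sup" for N
  proof -
    have "(\<integral>p. u N p \<partial>\<pi>) = (1 / real (Suc N)) * (\<Sum>k=1..Suc N * Suc N. measure \<pi> (U N k))"
      unfolding u_def using U_sets fin.emeasure_finite by (simp add: less_top[symmetric] del: of_nat_Suc)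
    also have "\<dots> \<le> (1 / real (Suc N)) * (\<Sum>k=1..Suc N * Suc N. m (U N k))"
      by (intro mult_left_mono sum_mono open_le U) auto
    also have "\<dots> = \<Lambda> (u N)"
      using sum_L L_scale[of "\<lambda>p. \<Sum>k=1..Suc N * Suc N. indicator (U N k) p" "1 / real (Suc N)"]
      unfolding u_def by (metis of_nat_0_less_iff zero_less_Suc zero_less_divide_1_iff)
    also have "\<dots> \<le> dual_sup"
    proof (rule L_cost)
      show "u N \<in> bounded_on_pairs"
        unfolding u_def using bounded_on_pairs_scale sum_L by blast
    qed (rule u_bound)
    finally show ?thesis
      using nn_integral_eq_integral[OF u_integrable] u_nonneg by (simp add: ennreal_leI)
  qed
  have u_lim: "(\<lambda>N. u N p) \<longlonglongrightarrow> dist2 p" for p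
  proof (rule tendsto_sandwich)
    show "\<forall>\<^sub>F N in sequentially. u N p \<le> dist2 p" using u_bound by simp
    obtain N0 where N0: "dist2 p < real N0" using reals_Archimedean2 by blast
    have "dist2 p - 1 / real (Suc N) \<le> u N p" if "N0 \<le> N" for N
    proof (rule ccontr)
      assume "\<not> ?thesis"
      moreover have "0 \<le> 1 / real (Suc N)" by simp
      ultimately have "real (Suc N) \<le> dist2 p" using u_bound(2)[of p N] by linarith
      then show False using that N0 by auto
    qed
    then show "\<forall>\<^sub>F N in sequentially. dist2 p - 1 / real (Suc N) \<le> u N p"
      unfolding eventually_sequentially by blast
    show "(\<lambda>N. dist2 p - 1 / real (Suc N)) \<longlonglongrightarrow> dist2 p"
      using tendsto_diff[OF tendsto_const LIMSEQ_inverse_real_of_nat, of "dist2 p"] by (simp add: inverse_eq_divide)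
  qed auto
  have "ennreal (dist2 p) = liminf (\<lambda>N. ennreal (u N p))" for p
    using lim_imp_Liminf[OF _ tendsto_ennrealI[OF u_lim]] by simp
  \<comment> \<open>The staircases are in general not monotone in \<open>N\<close>, so the limit is
    taken by Fatou's lemma.\<close>
  then have "transport_cost d \<pi> = (\<integral>\<^sup>+p. liminf (\<lambda>N. ennreal (u N p)) \<partial>\<pi>)"
    by (simp add: transport_cost_def)
  also have "\<dots> \<le> liminf (\<lambda>N. \<integral>\<^sup>+p. ennreal (u N p) \<partial>\<pi>)"
    using borel_measurable_integrable[OF u_integrable] by (intro nn_integral_liminf) auto
  also have "\<dots> \<le> liminf (\<lambda>N. ennreal dual_sup)"
    using u_int by (intro Liminf_mono always_eventually allI)
  also have "\<dots> = ennreal dual_sup" by (simp add: Liminf_const)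
  finally show ?thesis by (rule that[OF coupling])
qed

end

subsection \<open>Cyclical monotonicity\<close>

lemma cyclically_monotonic_subset:
  "cyclically_monotonic d C \<Longrightarrow> B \<subseteq> C \<Longrightarrow> cyclically_monotonic d B"
  unfolding cyclically_monotonic_def by (meson subset_iff)

text \<open>Replaces a set measurable only for the completion by a Borel set, to which inner
  regularity applies.\<close>

lemma concentrated_on_borelE:
  assumes "concentrated_on M C"
  obtains B where "B \<in> sets M" "B \<subseteq> C" "emeasure M (space M - B) = 0"
proof -
  have C: "C \<in> sets (completion M)" and null: "emeasure (completion M) (space M - C) = 0"
    using assms by (auto simp: concentrated_on_def)
  have "space M - C \<in> null_sets (completion M)"
    using C null sets.compl_sets[OF C] by (auto simp: null_sets_def)
  then obtain N where N: "N \<in> null_sets M" "space M - C \<subseteq> N"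
    unfolding null_sets_completion_iff2 by blast
  show ?thesis
  proof
    show "space M - N \<in> sets M" "space M - N \<subseteq> C" using N by auto
    have "space M - (space M - N) = N" using sets.sets_into_space[of N M] N by auto
    then show "emeasure M (space M - (space M - N)) = 0" using N by auto
  qed
qed

lemma concentrated_on_compl_null:
  assumes "N \<in> null_sets M"
  shows "concentrated_on M (space M - N)"
proof -
  have "space M - (space M - N) = N" using sets.sets_into_space[of N M] assms by auto
  then show ?thesis
    using assms null_setsD1[OF null_sets_completionI[OF assms]] by (auto simp: concentrated_on_def)
qed

context closed_nbd_metric
begin

text \<open>
  Signed cost of the chain that leaves \<open>y\<close>, runs through the pairs \<open>(x, y')\<close> of \<open>ps\<close> (gaining
  \<open>d x y'\<close> on each) and ends at \<open>x0\<close>.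
\<close>

fun return_cost :: "'a \<Rightarrow> ('a \<times> 'a) list \<Rightarrow> 'a \<Rightarrow> real" where
  "return_cost x0 [] y = d y x0"
| "return_cost x0 ((x, y') # ps) y = d y x - d x y' + return_cost x0 ps y'"

text \<open>Unrolls the recursion into the two sums compared in cyclical monotonicity; entry
  \<open>i\<close> of \<open>q # ps\<close> is the predecessor of \<open>ps ! i\<close>.\<close>

lemma return_cost_eq:
  "return_cost x0 ps (snd q) + (\<Sum>i<length ps. d (fst (ps ! i)) (snd (ps ! i))) =
   (\<Sum>i<length ps. d (snd ((q # ps) ! i)) (fst (ps ! i))) + d (snd ((q # ps) ! length ps)) x0"
proof (induction ps arbitrary: q)
  case (Cons p ps)
  show ?case
    using Cons.IH[of p] by (cases p) (simp add: sum.lessThan_Suc_shift del: sum.lessThan_Suc)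
qed simp

lemma return_cost_ge:
  assumes C: "cyclically_monotonic d C" "(x0, y0) \<in> C" "set ps \<subseteq> C"
  shows "d x0 y0 \<le> return_cost x0 ps y0"
proof -
  define n where "n = length ps"
  define qs where "qs = (x0, y0) # ps"
  define x where "x k = fst (qs ! (k - 1))" for k :: nat
  define y where "y k = snd (qs ! (k - 1))" for k :: nat
  \<comment> \<open>The cyclic shift: every first coordinate is paired with the second coordinate of
    its predecessor, and \<open>x0\<close> with that of the last pair, which closes the chain.
    Indices start at 1 here and at 0 in the lists.\<close>
  define \<sigma> where "\<sigma> k = (if k = 1 then Suc n else if k \<in> {1..Suc n} then k - 1 else k)" for k
  have "\<sigma> permutes {1..Suc n}"
  proof (rule bij_imp_permutes)
    have "inj_on \<sigma> {1..Suc n}" by (auto simp: inj_on_def \<sigma>_def split: if_splits)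
    moreover have "\<sigma> ` {1..Suc n} \<subseteq> {1..Suc n}" by (auto simp: \<sigma>_def)
    ultimately show "bij_betw \<sigma> {1..Suc n} {1..Suc n}"
      by (simp add: bij_betw_def endo_inj_surj)
  qed (auto simp: \<sigma>_def)
  moreover have "\<forall>k\<in>{1..Suc n}. (x k, y k) \<in> C"
  proof
    fix k assume "k \<in> {1..Suc n}"
    then have "qs ! (k - 1) \<in> set qs" by (intro nth_mem) (auto simp: qs_def n_def)
    then show "(x k, y k) \<in> C" using C by (auto simp: x_def y_def qs_def)
  qed
  ultimately have "(\<Sum>k=1..Suc n. d (x k) (y k)) \<le> (\<Sum>k=1..Suc n. d (x k) (y (\<sigma> k)))"
    using C(1) unfolding cyclically_monotonic_def by blast
  moreover have shift: "(\<Sum>k=1..Suc n. h k) = h 1 + (\<Sum>k<n. h (Suc (Suc k)))" for h :: "nat \<Rightarrow> real"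
    using sum.atLeast1_atMost_eq[of h "Suc n"] by (simp add: sum.lessThan_Suc_shift del: sum.lessThan_Suc sum.cl_ivl_Suc)
  ultimately have le: "d (x 1) (y 1) + (\<Sum>k<n. d (x (Suc (Suc k))) (y (Suc (Suc k)))) \<le>
      d (x 1) (y (\<sigma> 1)) + (\<Sum>k<n. d (x (Suc (Suc k))) (y (\<sigma> (Suc (Suc k)))))"
    by (simp only: shift)
  have "(\<Sum>k<n. d (x (Suc (Suc k))) (y (\<sigma> (Suc (Suc k))))) = (\<Sum>k<n. d (snd (qs ! k)) (fst (ps ! k)))"
    by (intro sum.cong) (auto simp: x_def y_def \<sigma>_def qs_def commute)
  moreover have "(\<Sum>k<n. d (x (Suc (Suc k))) (y (Suc (Suc k)))) = (\<Sum>k<n. d (fst (ps ! k)) (snd (ps ! k)))"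
    by (simp add: x_def y_def qs_def)
  moreover have "x 1 = x0" "y 1 = y0" "y (\<sigma> 1) = snd (qs ! n)"
    by (auto simp: x_def y_def qs_def \<sigma>_def)
  ultimately show ?thesis
    using le return_cost_eq[of x0 ps "(x0, y0)", folded qs_def n_def] commute[of x0 "snd (qs ! n)"] by simp
qed

text \<open>
  Rockafellar's potential along chains in \<open>K\<close>; compactness of \<open>K\<close> and upper semicontinuity of
  \<open>d\<close> on \<open>K\<close> keep every finite stage lower semicontinuous, so that the potential is Borel.
\<close>

lemma cyclically_monotonic_potential:
  assumes K: "compact K" "cyclically_monotonic d K"
    and usc: "\<And>p s. p \<in> K \<Longrightarrow> d (fst p) (snd p) < s \<Longrightarrow>
      \<exists>W. open W \<and> p \<in> W \<and> (\<forall>p'\<in>K \<inter> W. d (fst p') (snd p') < s)"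
  obtains f :: "'a \<Rightarrow> real" where "f \<in> borel_measurable borel" "\<forall>x y. \<bar>f x - f y\<bar> \<le> d x y"
    "\<forall>(x, y)\<in>K. d x y \<le> f x - f y"
proof (cases "K = {}")
  case True
  then show ?thesis by (intro that[of "\<lambda>_. 0"]) auto
next
  case False
  then obtain x0 y0 where xy0: "(x0, y0) \<in> K" by auto
  \<comment> \<open>\<open>g n z\<close> is the infimum of the signed costs of chains from
    \<open>y0\<close> to \<open>z\<close> through \<open>n\<close> pairs of \<open>K\<close>.
    Recursion on the last pair, rather than an infimum over lists, lets semicontinuity be proved by
    induction.\<close>
  define g :: "nat \<Rightarrow> 'a \<Rightarrow> real" where
    "g = rec_nat (d y0) (\<lambda>_ h z. INF (x, y)\<in>K. h x - d x y + d y z)"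
  have g0: "g 0 z = d y0 z" for z by (simp add: g_def)
  have gS: "g (Suc n) z = (INF p\<in>K. g n (fst p) - d (fst p) (snd p) + d (snd p) z)" for n z
    by (simp add: g_def case_prod_unfold)
  have gS_ge: "c \<le> g (Suc n) z" if "\<And>x y. (x, y) \<in> K \<Longrightarrow> c \<le> g n x - d x y + d y z" for c n z
    unfolding gS using that False by (intro cINF_greatest) auto
  \<comment> \<open>The way back \<open>ps\<close> is arbitrary so that the induction can move one
    pair at a time from \<open>g\<close> into \<open>return_cost\<close>; at \<open>n = 0\<close>
    the whole chain is a cycle and cyclical monotonicity applies.\<close>
  have chain: "d x0 y0 \<le> g n x - d x y + return_cost x0 ps y"
    if "(x, y) \<in> K" "set ps \<subseteq> K" for n x y ps
    using that
  proof (induction n arbitrary: x y ps)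
    case 0
    then show ?case
      using return_cost_ge[OF K(2) xy0, of "(x, y) # ps"] by (simp add: g0)
  next
    case (Suc n)
    have "d x0 y0 + d x y - return_cost x0 ps y \<le> g (Suc n) x"
    proof (rule gS_ge)
      fix x' y' assume "(x', y') \<in> K"
      then show "d x0 y0 + d x y - return_cost x0 ps y \<le> g n x' - d x' y' + d y' x"
        using Suc.IH[of x' y' "(x, y) # ps"] Suc.prems by simp
    qed
    then show ?case by simp
  qed
  \<comment> \<open>The bound depends neither on the pair nor on \<open>n\<close>, which makes the
    infimum over \<open>K\<close> and later the one over \<open>n\<close> finite.\<close>
  have term_ge: "d x0 y0 - d x0 z \<le> g n x - d x y + d y z" if "(x, y) \<in> K" for n x y z
    using chain[OF that, of "[]" n] triangle[of y z x0] commute[of z x0] by simp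
  have gS_le: "g (Suc n) z \<le> g n x - d x y + d y z" if "(x, y) \<in> K" for n x y z
    unfolding gS using term_ge[of _ _ z n] that
    by (intro cINF_lower2[of _ _ "(x, y)"] bdd_belowI[of _ "d x0 y0 - d x0 z"]) auto
  have g_ge: "d x0 y0 - d x0 z \<le> g n z" for n z
  proof (cases n)
    case 0
    then show ?thesis using triangle[of x0 z y0] commute[of z y0] by (simp add: g0)
  next
    case (Suc m)
    then show ?thesis using gS_ge[of "d x0 y0 - d x0 z" m z] term_ge by simp
  qed
  have g_lip: "g n z \<le> g n z' + d z' z" for n z z'
  proof (cases n)
    case 0
    then show ?thesis using triangle[of y0 z' z] by (simp add: g0)
  next
    case (Suc m)
    have "g (Suc m) z - d z' z \<le> g (Suc m) z'"
    proof (rule gS_ge)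
      fix x y assume "(x, y) \<in> K"
      from gS_le[OF this, of m z] show "g (Suc m) z - d z' z \<le> g m x - d x y + d y z'"
        using triangle[of y z' z] by simp
    qed
    then show ?thesis using Suc by simp
  qed
  have dist_nbhds: "\<exists>A B. open A \<and> open B \<and> y \<in> A \<and> z \<in> B \<and> (\<forall>y'\<in>A. \<forall>z'\<in>B. r < d y' z')"
    if "r < d y z" for r y z
  proof -
    have "(y, z) \<in> {p. r < d (fst p) (snd p)}" using that by simp
    from open_prod_elim[OF open_dist_greater this] obtain A B
      where "open A" "open B" "(y, z) \<in> A \<times> B" "A \<times> B \<subseteq> {p. r < d (fst p) (snd p)}" .
    then show ?thesis by (intro exI[of _ A] exI[of _ B]) auto
  qed
  have lsc: "open {z. r < g n z}" for n r
  proof (induction n arbitrary: r)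
    case 0
    show ?case
      unfolding g0
    proof (subst open_subopen, intro ballI)
      fix z assume "z \<in> {z. r < d y0 z}"
      then obtain A B where "open A" "open B" "y0 \<in> A" "z \<in> B" "\<forall>y'\<in>A. \<forall>z'\<in>B. r < d y' z'"
        using dist_nbhds[of r y0 z] by auto
      then show "\<exists>T. open T \<and> z \<in> T \<and> T \<subseteq> {z. r < d y0 z}" by (intro exI[of _ B]) auto
    qed
  next
    case (Suc n)
    show ?case
    proof (subst open_subopen, intro ballI)
      fix z0 assume "z0 \<in> {z. r < g (Suc n) z}"
      then obtain r' where r': "r < r'" "r' < g (Suc n) z0" using dense by auto
      \<comment> \<open>An infimum over a compact set of jointly lower semicontinuous terms is lower
        semicontinuous: finitely many \<open>A\<close> cover \<open>K\<close>, and the corresponding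
        \<open>B\<close> are intersected.\<close>
      have "\<forall>p\<in>K. \<exists>A B. open A \<and> open B \<and> p \<in> A \<and> z0 \<in> B \<and>
        (\<forall>p'\<in>K \<inter> A. \<forall>z\<in>B. r' < g n (fst p') - d (fst p') (snd p') + d (snd p') z)"
      proof
        fix p assume p: "p \<in> K"
        obtain x y where xy: "p = (x, y)" by (cases p)
        \<comment> \<open>A third of the surplus over \<open>r'\<close> for each of the three
          summands; the subtracted one is where upper semicontinuity of \<open>d\<close> on
          \<open>K\<close> enters.\<close>
        define e where "e = (g n x - d x y + d y z0 - r') / 3"
        have e: "0 < e" using gS_le[of x y n z0] p r' by (simp add: e_def xy)
        obtain W where W: "open W" "p \<in> W" "\<forall>p'\<in>K \<inter> W. d (fst p') (snd p') < d x y + e"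
          using usc[OF p, of "d x y + e"] e by (auto simp: xy)
        obtain A B where AB: "open A" "open B" "y \<in> A" "z0 \<in> B" "\<forall>y'\<in>A. \<forall>z\<in>B. d y z0 - e < d y' z"
          using dist_nbhds[of "d y z0 - e" y z0] e by auto
        have "open {x'. g n x - e < g n x'}" by (rule Suc.IH)
        then have "open (W \<inter> ({x'. g n x - e < g n x'} \<times> A))"
          using W AB by (intro open_Int open_Times)
        moreover have "r' < g n (fst p') - d (fst p') (snd p') + d (snd p') z"
          if "p' \<in> K \<inter> (W \<inter> ({x'. g n x - e < g n x'} \<times> A))" "z \<in> B" for p' z
        proof -
          have "g n x - e < g n (fst p')" "d (fst p') (snd p') < d x y + e" "d y z0 - e < d (snd p') z"
            using that W AB by auto
          moreover have "3 * e = g n x - d x y + d y z0 - r'" unfolding e_def by simp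
          ultimately show ?thesis by linarith
        qed
        moreover have "p \<in> W \<inter> ({x'. g n x - e < g n x'} \<times> A)" using W AB e by (auto simp: xy)
        ultimately show "\<exists>A B. open A \<and> open B \<and> p \<in> A \<and> z0 \<in> B \<and>
          (\<forall>p'\<in>K \<inter> A. \<forall>z\<in>B. r' < g n (fst p') - d (fst p') (snd p') + d (snd p') z)"
          using AB by (intro exI[of _ "W \<inter> ({x'. g n x - e < g n x'} \<times> A)"] exI[of _ B]) blast
      qed
      then obtain A B where AB: "\<forall>p\<in>K. open (A p) \<and> open (B p) \<and> p \<in> A p \<and> z0 \<in> B p \<and>
        (\<forall>p'\<in>K \<inter> A p. \<forall>z\<in>B p. r' < g n (fst p') - d (fst p') (snd p') + d (snd p') z)"
        by metis
      have cover: "K \<subseteq> (\<Union>p\<in>K. A p)" using AB by blast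
      have "open (A p)" if "p \<in> K" for p using AB that by blast
      from compactE_image[OF K(1) this cover]
      obtain P where P: "P \<subseteq> K" "finite P" "K \<subseteq> (\<Union>p\<in>P. A p)" by blast
      define V where "V = (\<Inter>p\<in>P. B p)"
      have "open V" unfolding V_def using P AB by (intro open_INT) auto
      moreover have "z0 \<in> V" unfolding V_def using P AB by blast
      moreover have "r < g (Suc n) z" if "z \<in> V" for z
      proof -
        have "r' \<le> g (Suc n) z"
        proof (rule gS_ge)
          fix x y assume xy: "(x, y) \<in> K"
          then obtain p where p: "p \<in> P" "(x, y) \<in> A p" using P by blast
          then have "z \<in> B p" "p \<in> K" using that P by (auto simp: V_def)
          with AB have "\<forall>p'\<in>K \<inter> A p. \<forall>z\<in>B p.
              r' < g n (fst p') - d (fst p') (snd p') + d (snd p') z" by blast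
          from bspec[OF bspec[OF this, of "(x, y)"] \<open>z \<in> B p\<close>] p xy
          show "r' \<le> g n x - d x y + d y z" by simp
        qed
        then show ?thesis using r' by simp
      qed
      ultimately show "\<exists>T. open T \<and> z0 \<in> T \<and> T \<subseteq> {z. r < g (Suc n) z}" by blast
    qed
  qed
  \<comment> \<open>Only countably many stages remain, so \<open>f\<close> is Borel, although
    semicontinuity may be lost in this infimum.\<close>
  define f where "f z = (INF n. g n z)" for z
  have bdd: "bdd_below (range (\<lambda>n. g n z))" for z
    using g_ge[of z] by (intro bdd_belowI[of _ "d x0 y0 - d x0 z"]) auto
  have f_le: "f z \<le> g n z" for n z unfolding f_def by (intro cINF_lower bdd) auto
  have f_ge: "c \<le> f z" if "\<And>n. c \<le> g n z" for c z unfolding f_def using that by (intro cINF_greatest) auto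
  show ?thesis
  proof
    have "g n \<in> borel_measurable borel" for n
      unfolding borel_measurable_iff_greater using lsc by auto
    then show "f \<in> borel_measurable borel"
      unfolding f_def using bdd by (intro borel_measurable_cINF) auto
    have *: "f x - f y \<le> d y x" for x y
    proof -
      have "f x - d y x \<le> f y"
        by (rule f_ge) (use order_trans[OF f_le g_lip, of x _ y] in \<open>simp add: diff_le_eq\<close>)
      then show ?thesis by simp
    qed
    show "\<forall>x y. \<bar>f x - f y\<bar> \<le> d x y"
      unfolding abs_le_iff using * commute by (metis minus_diff_eq)
    show "\<forall>(x, y)\<in>K. d x y \<le> f x - f y"
    proof safe
      fix x y assume xy: "(x, y) \<in> K"
      have "f y + d x y \<le> f x"
      proof (rule f_ge)
        fix n
        show "f y + d x y \<le> g n x" using f_le[of y "Suc n"] gS_le[OF xy, of n y] by simp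
      qed
      then show "d x y \<le> f x - f y" by simp
    qed
  qed
qed

end

section \<open>Optimal couplings and cyclically monotonic sets\<close>

context transport_problem
begin

text \<open>Lusin's argument for a lower semicontinuous function: for each rational level the open
  superlevel set is exchanged for a closed subset, and the differences, of total measure at most
  \<open>e / 2\<close>, are removed. On what remains these superlevel sets are relatively
  closed.\<close>

lemma usc_compact_subset:
  assumes \<pi>: "radon_measure \<pi>" and B: "B \<in> sets borel" and e: "0 < e"
  obtains K where "compact K" "K \<subseteq> B" "measure \<pi> (B - K) < e"
    "\<forall>p s. p \<in> K \<longrightarrow> dist2 p < s \<longrightarrow> (\<exists>W. open W \<and> p \<in> W \<and> (\<forall>p'\<in>K \<inter> W. dist2 p' < s))"
proof -
  interpret finite_measure \<pi> by (rule radon_measure_finite[OF \<pi>])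
  define q :: "nat \<Rightarrow> real" where "q = from_nat_into \<rat>"
  have q: "range q = \<rat>"
    unfolding q_def using Rats_0 by (intro range_from_nat_into countable_rat) auto
  have e2: "0 < e / 2" using e by simp
  obtain K0 where K0: "compact K0" "K0 \<subseteq> B" "measure \<pi> (B - K0) < e / 2"
    by (rule radon_measure_compact_inner[OF \<pi> B e2])
  define U where "U i = {p. q i < dist2 p}" for i
  have U: "open (U i)" for i unfolding U_def by (rule open_dist_greater)
  have "\<forall>i. \<exists>F. closed F \<and> F \<subseteq> U i \<and> measure \<pi> (U i - F) < e / 2 * (1/2) ^ Suc i"
    using e U by (intro allI radon_measure_closed_inner[OF \<pi>]) auto
  then obtain F where F: "\<And>i. closed (F i)" "\<And>i. F i \<subseteq> U i"
    "\<And>i. measure \<pi> (U i - F i) < e / 2 * (1/2) ^ Suc i" by metis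
  define K where "K = K0 \<inter> (\<Inter>i. F i \<union> - U i)"
  have sm: "(\<lambda>i. e / 2 * (1/2) ^ Suc i) sums (e / 2 * 1)" by (intro sums_mult power_half_series)
  have UF: "range (\<lambda>i. U i - F i) \<subseteq> sets \<pi>"
    using U F by (auto simp: radon_measure_sets[OF \<pi>])
  have summ: "summable (\<lambda>i. measure \<pi> (U i - F i))"
    by (rule summable_comparison_test'[OF sums_summable[OF sm], of 0]) (use F(3) in \<open>auto intro: less_imp_le\<close>)
  have KB: "B - K0 \<in> sets \<pi>" using B K0 by (auto simp: radon_measure_sets[OF \<pi>] borel_compact)
  have "measure \<pi> (B - K) \<le> measure \<pi> ((B - K0) \<union> (\<Union>i. U i - F i))"
    using KB UF by (intro finite_measure_mono) (auto simp: K_def)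
  also have "\<dots> \<le> measure \<pi> (B - K0) + measure \<pi> (\<Union>i. U i - F i)"
    using KB UF by (intro measure_Un_le) auto
  also have "measure \<pi> (\<Union>i. U i - F i) \<le> (\<Sum>i. measure \<pi> (U i - F i))"
    by (rule finite_measure_subadditive_countably[OF UF summ])
  also have "\<dots> \<le> (\<Sum>i. e / 2 * (1/2) ^ Suc i)"
    by (intro suminf_le summ sums_summable[OF sm] less_imp_le F(3))
  also have "\<dots> = e / 2" using sums_unique[OF sm] by simp
  finally have meas: "measure \<pi> (B - K) < e" using K0 by simp
  have "closed (\<Inter>i. F i \<union> - U i)" using F U by (intro closed_INT ballI closed_Un) (auto simp: closed_Compl)
  then have "compact K" unfolding K_def using K0 by (intro compact_Int_closed)
  moreover have "\<exists>W. open W \<and> p \<in> W \<and> (\<forall>p'\<in>K \<inter> W. dist2 p' < s)" if ps: "p \<in> K" "dist2 p < s" for p s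
  proof -
    obtain r where "r \<in> \<rat>" "dist2 p < r" "r < s" using Rats_dense_in_real[OF ps(2)] by blast
    then obtain i where i: "dist2 p < q i" "q i < s" using q by (metis rangeE)
    have "dist2 p' < s" if "p' \<in> K \<inter> - F i" for p'
      using that i by (fastforce simp: K_def U_def)
    moreover have "p \<in> - F i" using F(2)[of i] i by (auto simp: U_def)
    ultimately show ?thesis using F(1)[of i] by (intro exI[of _ "- F i"]) auto
  qed
  moreover have "K \<subseteq> B" using K0 by (auto simp: K_def)
  ultimately show ?thesis using meas by (intro that[of K]) blast+
qed

text \<open>Controls the cost off a compact set although \<open>d\<close> may be unbounded: there
  \<open>d\<close> is at most \<open>R\<close> plus this tail.\<close>

lemma integral_tail_le:
  assumes \<pi>: "\<pi> \<in> couplings \<mu> \<nu>" and e: "0 < e"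
  obtains R :: real where "0 < R" "(\<integral>p. max 0 (dist2 p - R) \<partial>\<pi>) < e"
proof -
  note int = coupling_integrable_dist2[OF \<pi>]
  have "(\<lambda>n. \<integral>p. max 0 (dist2 p - real n) \<partial>\<pi>) \<longlonglongrightarrow> (\<integral>p. 0 \<partial>\<pi>)"
  proof (rule integral_dominated_convergence[where w = dist2])
    show "AE p in \<pi>. (\<lambda>n. max 0 (dist2 p - real n)) \<longlonglongrightarrow> 0"
    proof (intro AE_I2)
      fix p
      obtain N where N: "dist2 p < real N" using reals_Archimedean2 by blast
      have "\<forall>n\<ge>N. max 0 (dist2 p - real n) = 0" using N by auto
      then have "\<forall>\<^sub>F n in sequentially. max 0 (dist2 p - real n) = 0"
        unfolding eventually_sequentially by blast
      then show "(\<lambda>n. max 0 (dist2 p - real n)) \<longlonglongrightarrow> 0" by (rule tendsto_eventually)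
    qed
  qed (use int borel_measurable_integrable[OF int] in auto)
  then have "\<forall>\<^sub>F n in sequentially. (\<integral>p. max 0 (dist2 p - real n) \<partial>\<pi>) < e"
    using e by (intro order_tendstoD(2)) auto
  then obtain N where N: "\<And>n. N \<le> n \<Longrightarrow> (\<integral>p. max 0 (dist2 p - real n) \<partial>\<pi>) < e"
    unfolding eventually_sequentially by blast
  show ?thesis by (rule that[of "real (Suc N)"]) (use N[of "Suc N"] in auto)
qed

text \<open>The potential is merely Borel and so no competitor for \<open>dual_sup\<close>. It is
  therefore compared with the cost of the other coupling directly: weak duality holds for all Borel
  functions that are 1-Lipschitz for \<open>d\<close>.\<close>

theorem cyclically_monotonic_imp_optimal:
  assumes \<pi>: "\<pi> \<in> couplings \<mu> \<nu>" and \<pi>': "\<pi>' \<in> couplings \<mu> \<nu>"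
    and C: "cyclically_monotonic d C" "concentrated_on \<pi> C"
  shows "(\<integral>p. dist2 p \<partial>\<pi>) \<le> (\<integral>p. dist2 p \<partial>\<pi>')"
proof (rule field_le_epsilon)
  fix e :: real assume e: "0 < e"
  have rad: "radon_measure \<pi>" and "prob_space \<pi>" using \<pi> by (auto simp: couplings_def)
  interpret prob_space \<pi> by fact
  note sets = radon_measure_sets[OF rad] and space = radon_measure_space[OF rad]
  note int = coupling_integrable_dist2[OF \<pi>]
  obtain B where B: "B \<in> sets \<pi>" "B \<subseteq> C" "emeasure \<pi> (space \<pi> - B) = 0"
    by (rule concentrated_on_borelE[OF C(2)])
  have e4: "0 < e / 4" using e by simp
  obtain R where R: "0 < R" "(\<integral>p. max 0 (dist2 p - R) \<partial>\<pi>) < e / 4"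
    by (rule integral_tail_le[OF \<pi> e4])
  have \<delta>: "0 < e / 4 / R" using e R by simp
  have "B \<in> sets borel" using B sets by simp
  obtain K where K: "compact K" "K \<subseteq> B" "measure \<pi> (B - K) < e / 4 / R"
    and usc: "\<forall>p s. p \<in> K \<longrightarrow> dist2 p < s \<longrightarrow> (\<exists>W. open W \<and> p \<in> W \<and> (\<forall>p'\<in>K \<inter> W. dist2 p' < s))"
    by (rule usc_compact_subset[OF rad \<open>B \<in> sets borel\<close> \<delta>])
  have Ks: "K \<in> sets \<pi>" using K by (simp add: sets borel_compact)
  have "measure \<pi> (- K) \<le> measure \<pi> ((B - K) \<union> (space \<pi> - B))"
    by (intro finite_measure_mono sets.Un sets.Diff sets.top B Ks) (auto simp: space)
  also have "\<dots> \<le> measure \<pi> (B - K) + measure \<pi> (space \<pi> - B)"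
    using B Ks by (intro measure_Un_le) auto
  also have "measure \<pi> (space \<pi> - B) = 0" using B by (simp add: measure_def)
  finally have "measure \<pi> (- K) \<le> e / 4 / R" using K by simp
  then have mK: "R * measure \<pi> (- K) \<le> e / 4" using R by (simp add: field_simps)
  have K_cm: "cyclically_monotonic d K"
    using K B by (intro cyclically_monotonic_subset[OF C(1)]) auto
  obtain f :: "'a \<Rightarrow> real" where f: "f \<in> borel_measurable borel" "\<forall>x y. \<bar>f x - f y\<bar> \<le> d x y"
    "\<forall>(x, y)\<in>K. d x y \<le> f x - f y"
    by (rule cyclically_monotonic_potential[OF K(1) K_cm usc[rule_format]])
  note lip = f(2)[rule_format]
  have mKc: "- K \<in> sets \<pi>" using Ks by (metis Compl_eq_Diff_UNIV sets.compl_sets space)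
  \<comment> \<open>Off \<open>K\<close> only \<open>f (fst p) - f (snd p) \<ge> - dist2 p\<close>
    is known, so \<open>dist2\<close> is needed twice there. This factor 2 and the two error terms
    account for \<open>e / 4\<close>.\<close>
  have pt: "dist2 p \<le> (f (fst p) - f (snd p)) + 2 * (R * indicator (- K) p + max 0 (dist2 p - R))" for p
  proof (cases "p \<in> K")
    case True
    then have "dist2 p \<le> f (fst p) - f (snd p)" using f(3) by auto
    moreover have "0 \<le> R * indicator (- K) p" using R by simp
    ultimately show ?thesis by (simp add: max_def)
  next
    case False
    then show ?thesis using lip[of "fst p" "snd p"] R by (auto simp: max_def abs_le_iff)
  qed
  have i1: "integrable \<pi> (\<lambda>p. f (fst p) - f (snd p))" by (rule dual_value_coupling(1)[OF \<pi> f(1) lip])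
  have i2: "integrable \<pi> (\<lambda>p. max 0 (dist2 p - R))"
    by (rule Bochner_Integration.integrable_bound[OF int])
      (use R borel_measurable_integrable[OF int] in auto)
  have i3: "integrable \<pi> (\<lambda>p. R * indicator (- K) p)"
    using mKc emeasure_finite by (auto simp: less_top[symmetric])
  have "(\<integral>p. dist2 p \<partial>\<pi>) \<le>
    (\<integral>p. (f (fst p) - f (snd p)) + 2 * (R * indicator (- K) p + max 0 (dist2 p - R)) \<partial>\<pi>)"
    by (intro integral_mono int pt Bochner_Integration.integrable_add i1 integrable_mult_right i2 i3)
  also have "\<dots> = dual_value f + 2 * (R * measure \<pi> (- K) + (\<integral>p. max 0 (dist2 p - R) \<partial>\<pi>))"
    using i1 i2 i3 mKc dual_value_coupling(2)[OF \<pi> f(1) lip]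
    by (simp add: Bochner_Integration.integral_add del: Bochner_Integration.integral_diff)
  also have "\<dots> \<le> dual_value f + e" using mK R by simp
  also have "dual_value f \<le> (\<integral>p. dist2 p \<partial>\<pi>')" by (rule dual_value_coupling(3)[OF \<pi>' f(1) lip])
  finally show "(\<integral>p. dist2 p \<partial>\<pi>) \<le> (\<integral>p. dist2 p \<partial>\<pi>') + e" by simp
qed

text \<open>Cyclical monotonicity involves finitely many pairs at a time, so almost optimal
  functions suffice if their slack \<open>g\<close> tends to 0 at each pair. Slacks are nonnegative
  with integrals tending to 0, and one null set serves all families of pairs.\<close>

theorem optimal_imp_cyclically_monotonic:
  assumes \<pi>: "\<pi> \<in> couplings \<mu> \<nu>" and opt: "(\<integral>p. dist2 p \<partial>\<pi>) \<le> dual_sup"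
  obtains C where "cyclically_monotonic d C" "concentrated_on \<pi> C"
proof -
  have rad: "radon_measure \<pi>" using \<pi> by (auto simp: couplings_def)
  note int = coupling_integrable_dist2[OF \<pi>]
  have "\<exists>f\<in>continuous_lipschitz1 d. dual_sup - 1 / real (Suc n) < dual_value f" for n
    using less_cSUP_iff[of "continuous_lipschitz1 d" dual_value "dual_sup - 1 / real (Suc n)"]
      zero_continuous_lipschitz1 bdd_above_dual_value unfolding dual_sup_def[symmetric] by auto
  then obtain f where f: "\<And>n. f n \<in> continuous_lipschitz1 d"
    "\<And>n. dual_sup - 1 / real (Suc n) < dual_value (f n)" by metis
  define g where "g n p = dist2 p - (f n (fst p) - f n (snd p))" for n p
  have lip: "\<bar>f n x - f n y\<bar> \<le> d x y" for n x y by (rule continuous_lipschitz1D(2)[OF f(1)])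
  have g_nonneg: "0 \<le> g n p" for n p using lip[of n "fst p" "snd p"] by (simp add: g_def)
  have diff_int: "integrable \<pi> (\<lambda>p. f n (fst p) - f n (snd p))" for n
    by (rule dual_value_coupling(1)[OF \<pi> continuous_lipschitz1D[OF f(1)]])
  have g_int: "integrable \<pi> (g n)" for n
    unfolding g_def by (intro Bochner_Integration.integrable_diff int diff_int)
  have "(\<integral>p. g n p \<partial>\<pi>) = (\<integral>p. dist2 p \<partial>\<pi>) - dual_value (f n)" for n
    unfolding g_def dual_value_coupling(2)[OF \<pi> continuous_lipschitz1D[OF f(1)]]
    by (intro Bochner_Integration.integral_diff int diff_int)
  then have g_le: "(\<integral>p. g n p \<partial>\<pi>) \<le> inverse (real (Suc n))" for n
    using f(2)[of n] opt by (simp add: inverse_eq_divide)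
  have "(\<lambda>n. \<integral>p. norm (g n p) \<partial>\<pi>) \<longlonglongrightarrow> 0"
  proof (rule tendsto_sandwich[OF _ _ tendsto_const LIMSEQ_inverse_real_of_nat])
    show "\<forall>\<^sub>F n in sequentially. 0 \<le> (\<integral>p. norm (g n p) \<partial>\<pi>)" by simp
    show "\<forall>\<^sub>F n in sequentially. (\<integral>p. norm (g n p) \<partial>\<pi>) \<le> inverse (real (Suc n))"
      using g_le g_nonneg by (simp add: abs_of_nonneg)
  qed
  from tendsto_L1_AE_subseq[OF g_int this]
  obtain r where ae: "AE p in \<pi>. (\<lambda>n. g (r n) p) \<longlonglongrightarrow> 0" by blast
  then obtain N where N: "N \<in> null_sets \<pi>" "{p\<in>space \<pi>. \<not> (\<lambda>n. g (r n) p) \<longlonglongrightarrow> 0} \<subseteq> N"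
    by (auto simp: eventually_ae_filter)
  have "cyclically_monotonic d (space \<pi> - N)"
    unfolding cyclically_monotonic_def
  proof (intro allI impI, elim conjE)
    fix n :: nat and x y :: "nat \<Rightarrow> 'a" and \<sigma>
    assume xy: "\<forall>k\<in>{1..n}. (x k, y k) \<in> space \<pi> - N" and \<sigma>: "\<sigma> permutes {1..n}"
    have "(\<lambda>i. \<Sum>k=1..n. g (r i) (x k, y k)) \<longlonglongrightarrow> (\<Sum>k=1..n. 0)"
      using xy N by (intro tendsto_sum) auto
    then have lim: "(\<lambda>i. (\<Sum>k=1..n. d (x k) (y k)) - (\<Sum>k=1..n. g (r i) (x k, y k)))
        \<longlonglongrightarrow> (\<Sum>k=1..n. d (x k) (y k)) - 0"
      by (intro tendsto_diff tendsto_const) simp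
    have "(\<Sum>k=1..n. d (x k) (y k)) - (\<Sum>k=1..n. g i (x k, y k)) \<le> (\<Sum>k=1..n. d (x k) (y (\<sigma> k)))" for i
    proof -
      have "(\<Sum>k=1..n. d (x k) (y k)) - (\<Sum>k=1..n. g i (x k, y k)) = (\<Sum>k=1..n. f i (x k)) - (\<Sum>k=1..n. f i (y k))"
        by (simp add: g_def sum_subtractf)
      \<comment> \<open>A difference of potentials ignores how the points are paired, so any
        \<sigma> may be inserted before the Lipschitz bound.\<close>
      also have "(\<Sum>k=1..n. f i (y k)) = (\<Sum>k=1..n. f i (y (\<sigma> k)))"
        using sum.permute[OF \<sigma>, of "\<lambda>k. f i (y k)"] by (simp add: o_def)
      also have "(\<Sum>k=1..n. f i (x k)) - (\<Sum>k=1..n. f i (y (\<sigma> k))) = (\<Sum>k=1..n. f i (x k) - f i (y (\<sigma> k)))"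
        by (simp add: sum_subtractf)
      also have "\<dots> \<le> (\<Sum>k=1..n. d (x k) (y (\<sigma> k)))"
        using lip[of i] by (intro sum_mono) (auto simp: abs_le_iff)
      finally show ?thesis .
    qed
    then show "(\<Sum>k=1..n. d (x k) (y k)) \<le> (\<Sum>k=1..n. d (x k) (y (\<sigma> k)))"
      using LIMSEQ_le_const2[OF lim] by simp
  qed
  then show ?thesis using concentrated_on_compl_null[OF N(1)] by (rule that)
qed

end

theorem theorem4p3:
  fixes d :: "'a::t4_space \<Rightarrow> 'a \<Rightarrow> real"
    and \<mu> \<nu> :: "'a measure"
  assumes metric: "Metric_space UNIV d"
    and closed_nbhd: "\<And>A r. closed A \<Longrightarrow> r > 0 \<Longrightarrow> closed {x. set_distance d x A \<le> ereal r}"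
    and mu: "radon_measure \<mu>" "prob_space \<mu>" "finite_first_moment d \<mu>"
    and nu: "radon_measure \<nu>" "prob_space \<nu>" "finite_first_moment d \<nu>"
  shows "enn2ereal (INF \<pi>\<in>couplings \<mu> \<nu>. transport_cost d \<pi>) =
           (SUP f\<in>continuous_lipschitz1 d. ereal ((\<integral>x. f x \<partial>\<mu>) - (\<integral>x. f x \<partial>\<nu>))) \<and>
         (\<exists>\<pi>\<in>couplings \<mu> \<nu>. transport_cost d \<pi> = (INF \<pi>'\<in>couplings \<mu> \<nu>. transport_cost d \<pi>')) \<and>
         (\<forall>\<pi>\<in>couplings \<mu> \<nu>.
            transport_cost d \<pi> = (INF \<pi>'\<in>couplings \<mu> \<nu>. transport_cost d \<pi>') \<longleftrightarrow>
            (\<exists>C. cyclically_monotonic d C \<and> concentrated_on \<pi> C))"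
proof -
  interpret transport_problem d \<mu> \<nu>
    by (intro transport_problem.intro closed_nbd_metric.intro metric
        closed_nbd_metric_axioms.intro transport_problem_axioms.intro closed_nbhd mu nu)
  obtain \<pi>0 where \<pi>0: "\<pi>0 \<in> couplings \<mu> \<nu>" "transport_cost d \<pi>0 \<le> ennreal dual_sup"
    by (rule optimal_coupling_exists)
  have cost_ge: "ennreal dual_sup \<le> transport_cost d \<pi>" if "\<pi> \<in> couplings \<mu> \<nu>" for \<pi>
    using dual_sup_le_cost[OF that] transport_cost_eq[OF that] by (simp add: ennreal_leI)
  have inf: "(INF \<pi>\<in>couplings \<mu> \<nu>. transport_cost d \<pi>) = ennreal dual_sup"
    by (rule antisym) (use \<pi>0 cost_ge in \<open>auto intro: INF_lower2 INF_greatest\<close>)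
  \<comment> \<open>This bound and the lower bound 0 show that the extended-real supremum is finite
    and hence agrees with the real one.\<close>
  have "(SUP f\<in>continuous_lipschitz1 d. ereal (dual_value f)) \<le> ereal dual_sup"
    by (intro SUP_least) (simp add: dual_value_le_sup)
  moreover have "0 \<le> (SUP f\<in>continuous_lipschitz1 d. ereal (dual_value f))"
    by (rule SUP_upper2[OF zero_continuous_lipschitz1]) (simp add: dual_value_def)
  ultimately have sup: "(SUP f\<in>continuous_lipschitz1 d. ereal (dual_value f)) = ereal dual_sup"
    unfolding dual_sup_def by (intro ereal_SUP[symmetric]) auto
  have opt_iff: "transport_cost d \<pi> = ennreal dual_sup \<longleftrightarrow> (\<integral>p. dist2 p \<partial>\<pi>) \<le> dual_sup"
    if "\<pi> \<in> couplings \<mu> \<nu>" for \<pi>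
    using cost_ge[OF that] transport_cost_eq[OF that] dual_sup_nonneg
    by (auto simp: ennreal_le_iff2 order_antisym)
  have \<pi>0_cost: "transport_cost d \<pi>0 = ennreal dual_sup"
    using \<pi>0 cost_ge by (intro antisym) auto
  show ?thesis
    unfolding inf
  proof (intro conjI ballI)
    show "enn2ereal (ennreal dual_sup) =
        (SUP f\<in>continuous_lipschitz1 d. ereal ((\<integral>x. f x \<partial>\<mu>) - (\<integral>x. f x \<partial>\<nu>)))"
      using sup dual_sup_nonneg by (simp add: dual_value_def enn2ereal_ennreal)
    show "\<exists>\<pi>\<in>couplings \<mu> \<nu>. transport_cost d \<pi> = ennreal dual_sup"
      using \<pi>0(1) \<pi>0_cost by blast
    fix \<pi> assume \<pi>: "\<pi> \<in> couplings \<mu> \<nu>"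
    show "transport_cost d \<pi> = ennreal dual_sup \<longleftrightarrow> (\<exists>C. cyclically_monotonic d C \<and> concentrated_on \<pi> C)"
    proof
      assume "transport_cost d \<pi> = ennreal dual_sup"
      then have "(\<integral>p. dist2 p \<partial>\<pi>) \<le> dual_sup" using opt_iff[OF \<pi>] by simp
      from optimal_imp_cyclically_monotonic[OF \<pi> this]
      show "\<exists>C. cyclically_monotonic d C \<and> concentrated_on \<pi> C" by blast
    next
      assume "\<exists>C. cyclically_monotonic d C \<and> concentrated_on \<pi> C"
      then obtain C where "cyclically_monotonic d C" "concentrated_on \<pi> C" by blast
      from cyclically_monotonic_imp_optimal[OF \<pi> \<pi>0(1) this] opt_iff[OF \<pi>0(1)] \<pi>0_cost
      show "transport_cost d \<pi> = ennreal dual_sup" using opt_iff[OF \<pi>] by simp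
    qed
  qed
qed

end
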